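(* Let $n\ge 2$ and $R>0$. There exists a constant $\rho>0$ (depending only on $R$) such that for every $E\in\mathcal U_R$ and every $p_0\in\partial E$ the following holds. Let $C$ be the cylinder $\{x\in\mathbb R^{n-1}:|x|<\rho\}\times\,]-R,R[$ expressed with respect to a coordinate system belonging to $\mathcal S_{p_0}^{E}$. Then $\partial E\cap C$ is the graph of a function $f\in W^{2,\infty}(\{x\in\mathbb R^{n-1}:|x|<\rho\})$. Moreover, the $W^{2,\infty}$-norm of $f$ is bounded by a constant depending only on $R$ (independent of $p_0$, of $E$, and of the choice of the coordinate system in $\mathcal S_{p_0}^{E}$).
   Context: The dimension $n$ is fixed. $B(q,R)$ is the open ball in $\mathbb R^n$ centred at $q$ with radius $R$. $\mathcal U_R$ is the class of all closed and bounded sets $E\subset\mathbb R^n$ such that for every $p\in\partial E$ there exist points $p',p''$ with $p\in\partial B(p',R)\cap\partial B(p'',R)$, $B(p',R)\subset E$ and $B(p'',R)\cap E=\emptyset$. For $E\in\mathcal U_R$ and $p\in\partial E$, $p'$ and $p''$ denote the centres of these interior and exterior balls. $\mathcal S_p^{E}$ is the class of all (orthonormal) coordinate systems centred at $p$ such that the vector $\frac1{2R}(p''-p')$ coincides with the $n$-th vector of the coordinate basis. Points of $\mathbb R^n$ are written $(x,z)$ with $x\in\mathbb R^{n-1}$, $z\in\mathbb R$, and the graph of $f$ is $\{(x,z): z=f(x)\}$. *)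

theory Defs
  imports "HOL-Analysis.Analysis" "HOL-Probability.Essential_Supremum"
begin

section \<open>Sets with uniform interior and exterior balls\<close>

definition tangent_balls ::
  "real \<Rightarrow> (real ^ 'n) set \<Rightarrow> real ^ 'n \<Rightarrow> real ^ 'n \<Rightarrow> real ^ 'n \<Rightarrow> bool" where
  "tangent_balls R E p p' p'' \<longleftrightarrow>
     p \<in> frontier (ball p' R) \<inter> frontier (ball p'' R) \<and> ball p' R \<subseteq> E \<and> ball p'' R \<inter> E = {}"

definition ball_class :: "real \<Rightarrow> (real ^ 'n) set set" where
  "ball_class R =
     {E. closed E \<and> bounded E \<and> (\<forall>p \<in> frontier E. \<exists>p' p''. tangent_balls R E p p' p'')}"

text \<open>
  A coordinate system centred at \<open>p\<close> is given by its orthonormal basis, split as \<open>(e, \<nu>)\<close>: the family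
  \<open>e\<close> consists of the first \<open>n - 1\<close> vectors and \<open>\<nu>\<close> is the \<open>n\<close>-th one.  Orthonormality makes
  \<open>(e, \<nu>)\<close> a basis as soon as \<open>CARD('m) + 1 = CARD('n)\<close>.  For \<open>R > 0\<close> the two tangent balls
  are disjoint and touch at \<open>p\<close>, so \<open>p'\<close> and \<open>p''\<close> are uniquely determined by \<open>R\<close>, \<open>E\<close> and \<open>p\<close>; the
  existential quantifier below merely names them.
\<close>

definition orthonormal_frame :: "('m \<Rightarrow> real ^ 'n) \<times> (real ^ 'n) \<Rightarrow> bool" where
  "orthonormal_frame = (\<lambda>(e, \<nu>).
     (\<forall>i j. e i \<bullet> e j = (if i = j then 1 else 0)) \<and> (\<forall>i. e i \<bullet> \<nu> = 0) \<and> \<nu> \<bullet> \<nu> = 1)"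

definition coord_systems ::
  "real \<Rightarrow> (real ^ 'n) set \<Rightarrow> real ^ 'n \<Rightarrow> (('m \<Rightarrow> real ^ 'n) \<times> (real ^ 'n)) set" where
  "coord_systems R E p =
     {(e, \<nu>). orthonormal_frame (e, \<nu>) \<and>
        (\<exists>p' p''. tangent_balls R E p p' p'' \<and> \<nu> = (1 / (2 * R)) *\<^sub>R (p'' - p'))}"

definition from_coords ::
  "real ^ 'n \<Rightarrow> ('m::finite \<Rightarrow> real ^ 'n) \<times> (real ^ 'n) \<Rightarrow> (real ^ 'm) \<times> real \<Rightarrow> real ^ 'n" where
  "from_coords p = (\<lambda>(e, \<nu>) (x, z). p + (\<Sum>i\<in>UNIV. (x $ i) *\<^sub>R e i) + z *\<^sub>R \<nu>)"


section \<open>The Sobolev space $W^{k,\infty}$\<close>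

definition partial_deriv :: "'m::finite \<Rightarrow> (real ^ 'm \<Rightarrow> real) \<Rightarrow> real ^ 'm \<Rightarrow> real" where
  "partial_deriv i u x = frechet_derivative u (at x) (axis i 1)"

text \<open>
  A multi-index of order \<open>k\<close> is represented by a list of \<open>k\<close> coordinate indices, in which the
  order is irrelevant for smooth functions.
\<close>

definition partial_derivs :: "'m::finite list \<Rightarrow> (real ^ 'm \<Rightarrow> real) \<Rightarrow> real ^ 'm \<Rightarrow> real" where
  "partial_derivs is u = foldr partial_deriv is u"

definition test_functions :: "(real ^ 'm::finite) set \<Rightarrow> (real ^ 'm \<Rightarrow> real) set" where
  "test_functions \<Omega> =
     {\<phi>. (\<forall>is x. partial_derivs is \<phi> differentiable (at x)) \<and>
         compact (closure {x. \<phi> x \<noteq> 0}) \<and> closure {x. \<phi> x \<noteq> 0} \<subseteq> \<Omega>}"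

definition locally_integrable_on :: "(real ^ 'm::finite \<Rightarrow> real) \<Rightarrow> (real ^ 'm) set \<Rightarrow> bool" where
  "locally_integrable_on u \<Omega> \<longleftrightarrow> (\<forall>K. compact K \<and> K \<subseteq> \<Omega> \<longrightarrow> set_integrable lebesgue K u)"

definition has_weak_deriv ::
  "(real ^ 'm::finite) set \<Rightarrow> 'm list \<Rightarrow> (real ^ 'm \<Rightarrow> real) \<Rightarrow> (real ^ 'm \<Rightarrow> real) \<Rightarrow> bool" where
  "has_weak_deriv \<Omega> is u v \<longleftrightarrow>
     locally_integrable_on u \<Omega> \<and> locally_integrable_on v \<Omega> \<and>
     (\<forall>\<phi> \<in> test_functions \<Omega>.
        integral\<^sup>L (lebesgue_on \<Omega>) (\<lambda>x. u x * partial_derivs is \<phi> x) =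
        (- 1) ^ length is * integral\<^sup>L (lebesgue_on \<Omega>) (\<lambda>x. v x * \<phi> x))"

text \<open>\<^const>\<open>esssup\<close> is \<open>\<infinity>\<close> on functions that are not measurable.\<close>

definition Linf_norm :: "(real ^ 'm::finite) set \<Rightarrow> (real ^ 'm \<Rightarrow> real) \<Rightarrow> ennreal" where
  "Linf_norm \<Omega> u = esssup (lebesgue_on \<Omega>) (\<lambda>x. ennreal \<bar>u x\<bar>)"

definition Linf :: "(real ^ 'm::finite) set \<Rightarrow> (real ^ 'm \<Rightarrow> real) set" where
  "Linf \<Omega> = {u \<in> borel_measurable (lebesgue_on \<Omega>). Linf_norm \<Omega> u < \<infinity>}"

definition sobolev_inf :: "nat \<Rightarrow> (real ^ 'm::finite) set \<Rightarrow> (real ^ 'm \<Rightarrow> real) set" where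
  "sobolev_inf k \<Omega> = {u \<in> Linf \<Omega>. \<forall>is. length is \<le> k \<longrightarrow> (\<exists>v \<in> Linf \<Omega>. has_weak_deriv \<Omega> is u v)}"

text \<open>
  The maximum over all multi-indices of order at most \<open>k\<close> of the \<open>L\<^sup>\<infinity>\<close>-norm of the corresponding
  weak derivative.  Weak derivatives on an open set are unique up to null sets, so the infimum
  ranges over at most one value; it is \<open>\<infinity>\<close> if the weak derivative does not exist.
\<close>

definition sobolev_inf_norm :: "nat \<Rightarrow> (real ^ 'm::finite) set \<Rightarrow> (real ^ 'm \<Rightarrow> real) \<Rightarrow> ennreal" where
  "sobolev_inf_norm k \<Omega> u =
     (SUP is \<in> {is. length is \<le> k}. INF v \<in> {v. has_weak_deriv \<Omega> is u v}. Linf_norm \<Omega> v)"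

end

theory Submission imports Defs begin

text \<open>
  Two facts about the unit outer normals \<open>\<nu>\<close> of a set with tangent balls of radius \<open>R\<close> drive the
  proof.  The interior ball at one boundary point is disjoint from the exterior ball at any other;
  comparing the distances of their centres with \<open>2 R\<close>, in both pairings, gives by the parallelogram
  law that the normal is Lipschitz with constant \<open>1 / R\<close> (\<open>outer_normal_lipschitz\<close>).  And no boundary
  point lies in a tangent ball, so the boundary leaves its tangent plane at most quadratically
  (\<open>outer_normal_quadratic\<close>).  Over a disc of radius \<open>R / 4\<close> around \<open>p\<close> the normals are then within
  \<open>1 / 3\<close> of the normal at \<open>p\<close>.  Each vertical segment of the cylinder runs from the interior to the
  exterior ball and hence meets the boundary, and the quadratic estimate leaves room for just one
  intersection.  The same estimate says that the resulting function \<open>f\<close> is differentiable, its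
  gradient being the horizontal part of the normal divided by minus its vertical part; so the
  gradient is Lipschitz with a constant that depends only on \<open>R\<close>.

  It remains to see that such a \<open>C\<^sup>1\<^sup>,\<^sup>1\<close> function lies in \<open>W\<^sup>2\<^sup>,\<^sup>\<infinity>\<close> (\<open>C11_imp_sobolev_inf_2\<close>), for which
  Lipschitz functions must have bounded weak derivatives.  Rademacher's theorem is avoided: the
  difference quotients of a Lipschitz function are bounded by its Lipschitz constant, a bounded
  sequence on a finite measure space has a limit point in the weak sense
  (\<open>bounded_sequence_weak_limit\<close>), and a discrete integration by parts (\<open>diff_quot_by_parts\<close>)
  identifies this limit point as the weak derivative.
\<close>

section \<open>Weak limits of bounded sequences\<close>

lemma integrable_mult_bounded:
  fixes w \<psi> :: "'a \<Rightarrow> real"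
  assumes "integrable M \<psi>" "w \<in> borel_measurable M" "\<And>x. x \<in> space M \<Longrightarrow> \<bar>w x\<bar> \<le> K"
  shows "integrable M (\<lambda>x. w x * \<psi> x)"
proof (rule Bochner_Integration.integrable_bound)
  show "integrable M (\<lambda>x. K * \<psi> x)" using assms by auto
  show "(\<lambda>x. w x * \<psi> x) \<in> borel_measurable M" using assms by measurable
  show "AE x in M. norm (w x * \<psi> x) \<le> norm (K * \<psi> x)"
    using assms(3) by (intro AE_I2) (force simp: abs_mult intro!: mult_right_mono)
qed

text \<open>
  A sequential weak-star compactness, proved with the geometry of \<open>L\<^sup>2\<close>.  Let \<open>W N\<close> be the convex set
  of functions bounded by \<open>K\<close> that obey every estimate on an integral against an integrable \<open>\<psi>\<close>
  which holds for all \<open>v n\<close> with \<open>n \<ge> N\<close>.  Choosing in each \<open>W N\<close> an almost minimiser of the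
  \<open>L\<^sup>2\<close>-norm makes the choices a Cauchy sequence by the parallelogram law, and the almost everywhere
  limit of a subsequence lies, up to clipping, in every \<open>W N\<close>, which fixes its integral against \<open>\<psi>\<close>
  whenever the integrals of the \<open>v n\<close> converge.
\<close>

lemma (in finite_measure) bounded_sequence_weak_limit:
  fixes v :: "nat \<Rightarrow> 'a \<Rightarrow> real"
  assumes v: "\<And>n. v n \<in> borel_measurable M"
    and vK: "\<And>n x. x \<in> space M \<Longrightarrow> \<bar>v n x\<bar> \<le> K"
    and K: "0 \<le> K"
  obtains w where "w \<in> borel_measurable M" "\<And>x. \<bar>w x\<bar> \<le> K"
    "\<And>\<psi> L. integrable M \<psi> \<Longrightarrow> (\<lambda>n. \<integral>x. v n x * \<psi> x \<partial>M) \<longlonglongrightarrow> L \<Longrightarrow> (\<integral>x. w x * \<psi> x \<partial>M) = L"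
proof -
  define W where "W N = {w \<in> borel_measurable M. (\<forall>x \<in> space M. \<bar>w x\<bar> \<le> K) \<and>
    (\<forall>\<psi> L e. integrable M \<psi> \<longrightarrow> (\<forall>n\<ge>N. \<bar>(\<integral>x. v n x * \<psi> x \<partial>M) - L\<bar> \<le> e) \<longrightarrow>
       \<bar>(\<integral>x. w x * \<psi> x \<partial>M) - L\<bar> \<le> e)}" for N
  have WM[measurable_dest]: "w \<in> borel_measurable M" if "w \<in> W N" for w N
    using that by (auto simp: W_def)
  have WK: "\<bar>w x\<bar> \<le> K" if "w \<in> W N" "x \<in> space M" for w N x
    using that by (auto simp: W_def)
  have Wlim: "\<bar>(\<integral>x. w x * \<psi> x \<partial>M) - L\<bar> \<le> e"
    if "w \<in> W N" "integrable M \<psi>" "\<And>n. n \<ge> N \<Longrightarrow> \<bar>(\<integral>x. v n x * \<psi> x \<partial>M) - L\<bar> \<le> e" for w N \<psi> L e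
    using that by (auto simp: W_def)
  have vW: "v N \<in> W N" for N
    using v vK by (auto simp: W_def)
  have Wmono: "W j \<subseteq> W i" if "i \<le> j" for i j
    using that by (fastforce simp: W_def)
  have int: "integrable M (\<lambda>x. w x * \<psi> x)" if "w \<in> W N" "integrable M \<psi>" for w N \<psi>
    using integrable_mult_bounded[OF that(2) WM[OF that(1)] WK[OF that(1)]] .
  have int1: "integrable M w" if "w \<in> W N" for w N
    using int[OF that, of "\<lambda>_. 1"] by simp
  have Wmid: "(\<lambda>x. (a x + b x) / 2) \<in> W N" if a: "a \<in> W N" and b: "b \<in> W N" for a b N
  proof -
    have meas: "(\<lambda>x. (a x + b x) / 2) \<in> borel_measurable M"
      using a b WM by measurable
    have bd: "\<bar>(a x + b x) / 2\<bar> \<le> K" if "x \<in> space M" for x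
      using WK[OF a that] WK[OF b that] by (simp add: abs_le_iff)
    have "\<bar>(\<integral>x. (a x + b x) / 2 * \<psi> x \<partial>M) - L\<bar> \<le> e"
      if \<psi>: "integrable M \<psi>" and *: "\<forall>n\<ge>N. \<bar>(\<integral>x. v n x * \<psi> x \<partial>M) - L\<bar> \<le> e" for \<psi> L e
    proof -
      have "(\<integral>x. (a x + b x) / 2 * \<psi> x \<partial>M) = (\<integral>x. (a x * \<psi> x + b x * \<psi> x) / 2 \<partial>M)"
        by (simp add: field_simps)
      also have "\<dots> = ((\<integral>x. a x * \<psi> x \<partial>M) + (\<integral>x. b x * \<psi> x \<partial>M)) / 2"
        using int[OF a \<psi>] int[OF b \<psi>] by simp
      finally have eq: "(\<integral>x. (a x + b x) / 2 * \<psi> x \<partial>M) = \<dots>" .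
      have "\<bar>(\<integral>x. a x * \<psi> x \<partial>M) - L\<bar> \<le> e" "\<bar>(\<integral>x. b x * \<psi> x \<partial>M) - L\<bar> \<le> e"
        using * by (auto intro!: Wlim[OF a \<psi>] Wlim[OF b \<psi>])
      then show ?thesis
        unfolding eq by (auto simp: abs_le_iff field_simps)
    qed
    then show ?thesis
      using meas bd unfolding W_def by blast
  qed
  define I where "I w = (\<integral>x. w x * w x \<partial>M)" for w :: "'a \<Rightarrow> real"
  have I0: "0 \<le> I w" for w
    unfolding I_def by simp
  define c where "c N = Inf (I ` W N)" for N
  have bdd: "bdd_below (I ` W N)" for N
    using I0 by (auto intro!: bdd_belowI[of _ 0])
  have cI: "c N \<le> I w" if "w \<in> W N" for w N
    unfolding c_def using that bdd by (intro cINF_lower) auto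
  have cmono: "c i \<le> c j" if "i \<le> j" for i j
    unfolding c_def using Wmono[OF that] vW bdd by (intro cInf_superset_mono) (auto)
  have cbd: "c N \<le> K * K * measure M (space M)" for N
  proof -
    have "I (v N) \<le> (\<integral>x. K * K \<partial>M)"
      unfolding I_def
    proof (rule integral_mono)
      show "integrable M (\<lambda>x. v N x * v N x)" by (intro int[OF vW] int1[OF vW])
      show "v N x * v N x \<le> K * K" if "x \<in> space M" for x
        using vK[OF that, of N] K by (metis abs_ge_zero abs_mult_self_eq mult_mono)
    qed simp
    also have "\<dots> = K * K * measure M (space M)" by simp
    finally show ?thesis using cI[OF vW, of N] by linarith
  qed
  \<comment> \<open>The infima increase with \<open>N\<close>, as the sets shrink; being bounded
      they form a Cauchy sequence.\<close>
  have "incseq c"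
    using cmono by (auto simp: incseq_def)
  then have "Cauchy c"
    using cbd by (metis convergent_Cauchy incseq_convergent convergentI)
  have "\<exists>w \<in> W N. I w < c N + 1 / (real N + 1)" for N
  proof -
    have "\<exists>y \<in> I ` W N. y < c N + 1 / (real N + 1)"
      unfolding c_def using vW bdd by (intro cInf_lessD) (auto)
    then show ?thesis by auto
  qed
  then obtain w where wW: "\<And>N. w N \<in> W N" and wI: "\<And>N. I (w N) < c N + 1 / (real N + 1)"
    by metis
  \<comment> \<open>The parallelogram law, where the midpoint lies in \<open>W N\<close> and hence
      is not below the infimum \<open>c N\<close>.\<close>
  have L2: "(\<integral>x. (w i x - w j x) * (w i x - w j x) \<partial>M) \<le> 2 * (c i - c N) + 2 * (c j - c N) + 4 / (real N + 1)"
    if ij: "i \<ge> N" "j \<ge> N" for i j N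
  proof -
    have W: "w i \<in> W N" "w j \<in> W N"
      using wW Wmono ij by blast+
    note mid = Wmid[OF W]
    have "(\<integral>x. (w i x - w j x) * (w i x - w j x) \<partial>M) =
      (\<integral>x. 2 * (w i x * w i x) + 2 * (w j x * w j x) - 4 * ((w i x + w j x) / 2 * ((w i x + w j x) / 2)) \<partial>M)"
      by (intro Bochner_Integration.integral_cong refl) (simp add: field_simps)
    also have "\<dots> = 2 * I (w i) + 2 * I (w j) - 4 * I (\<lambda>x. (w i x + w j x) / 2)"
      unfolding I_def using int[OF W(1) int1[OF W(1)]] int[OF W(2) int1[OF W(2)]] int[OF mid int1[OF mid]]
      by (simp del: times_divide_eq_left times_divide_eq_right)
    also have "\<dots> \<le> 2 * (c i + 1 / (real N + 1)) + 2 * (c j + 1 / (real N + 1)) - 4 * c N"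
    proof -
      have "I (w k) \<le> c k + 1 / (real N + 1)" if "k \<ge> N" for k
      proof -
        have "1 / (real k + 1) \<le> 1 / (real N + 1)"
          using that by (simp add: frac_le)
        with wI[of k] show ?thesis by linarith
      qed
      then show ?thesis
        using ij cI[OF mid] by (intro diff_mono add_mono mult_left_mono) auto
    qed
    finally show ?thesis by (simp add: algebra_simps)
  qed
  have L1: "\<exists>N. \<forall>i\<ge>N. \<forall>j\<ge>N. (\<integral>x. norm (w i x - w j x) \<partial>M) < e" if "e > 0" for e
  proof -
    \<comment> \<open>Passage to \<open>L\<^sup>1\<close> by
        \<open>t \<le> d + t\<^sup>2 / d\<close>: the term \<open>d\<close> contributes less than
        \<open>e / 2\<close>, and \<open>s\<close> is chosen so that the other one contributes at
        most \<open>e / 2\<close>.\<close>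
    define d where "d = e / (2 * (measure M (space M) + 1))"
    have d: "d > 0" unfolding d_def using that by (simp add: add_nonneg_pos)
    have "d * measure M (space M) < d * (measure M (space M) + 1)"
      using d by simp
    also have "d * (measure M (space M) + 1) = e / 2"
      unfolding d_def by (simp add: field_simps add_nonneg_eq_0_iff)
    finally have dm: "d * measure M (space M) < e / 2" .
    define s where "s = d * e / 16"
    have s: "s > 0" unfolding s_def using d that by simp
    obtain N1 where N1: "\<And>m n. m \<ge> N1 \<Longrightarrow> n \<ge> N1 \<Longrightarrow> \<bar>c m - c n\<bar> < s"
      using \<open>Cauchy c\<close> s unfolding Cauchy_def dist_real_def by blast
    obtain N2 where N2: "1 / (real N2 + 1) < s"
      using nat_approx_posE[OF s] by (metis of_nat_Suc add.commute)
    define N where "N = max N1 N2"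
    have "(\<integral>x. norm (w i x - w j x) \<partial>M) < e" if ij: "i \<ge> N" "j \<ge> N" for i j
    proof -
      have W: "w i \<in> W N" "w j \<in> W N"
        using wW Wmono ij by blast+
      have "1 / (real N + 1) \<le> 1 / (real N2 + 1)"
        by (simp add: N_def frac_le)
      then have "4 / (real N + 1) < 4 * s" using N2 by simp
      moreover have "\<bar>c i - c N\<bar> < s" "\<bar>c j - c N\<bar> < s"
        using ij by (auto intro!: N1 simp: N_def)
      ultimately have "2 * (c i - c N) + 2 * (c j - c N) + 4 / (real N + 1) < 2 * s + 2 * s + 4 * s"
        by (intro add_strict_mono) auto
      then have le: "(\<integral>x. (w i x - w j x) * (w i x - w j x) \<partial>M) < 8 * s"
        using L2[OF ij] by (rule le_less_trans[rotated, THEN less_le_trans]) simp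
      have int2: "integrable M (\<lambda>x. (w i x - w j x) * (w i x - w j x))"
        using int[OF W(1) int1[OF W(1)]] int[OF W(2) int1[OF W(2)]] int[OF W(1) int1[OF W(2)]]
          int[OF W(2) int1[OF W(1)]]
        by (simp add: left_diff_distrib right_diff_distrib)
      have "(\<integral>x. norm (w i x - w j x) \<partial>M) \<le> (\<integral>x. d + (w i x - w j x) * (w i x - w j x) / d \<partial>M)"
      proof (rule integral_mono)
        show "integrable M (\<lambda>x. norm (w i x - w j x))"
          using int1[OF W(1)] int1[OF W(2)] by simp
        show "integrable M (\<lambda>x. d + (w i x - w j x) * (w i x - w j x) / d)"
          using int2 by simp
        show "norm (w i x - w j x) \<le> d + (w i x - w j x) * (w i x - w j x) / d" for x
        proof -
          define t where "t = \<bar>w i x - w j x\<bar>"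
          have "2 * (t * d) \<le> t * t + d * d"
            using sum_squares_bound[of t d] by (simp add: power2_eq_square mult.assoc)
          moreover have "0 \<le> t * d"
            using d by (simp add: t_def)
          ultimately have "t * d \<le> d * d + t * t"
            by linarith
          then have "t \<le> d + t * t / d"
            using d by (simp add: field_simps)
          then show ?thesis by (simp add: t_def)
        qed
      qed
      also have "\<dots> = d * measure M (space M) + (\<integral>x. (w i x - w j x) * (w i x - w j x) \<partial>M) / d"
        using int2 by simp
      also have "\<dots> < e / 2 + 8 * s / d"
        using dm le d by (intro add_strict_mono divide_strict_right_mono) auto
      also have "\<dots> = e"
        using d by (simp add: s_def)
      finally show ?thesis .
    qed
    then show ?thesis by blast
  qed
  obtain r where r: "strict_mono r" and cau: "AE x in M. Cauchy (\<lambda>i. w (r i) x)"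
    using cauchy_L1_AE_cauchy_subseq[of M w, OF int1[OF wW] L1] by blast
  \<comment> \<open>Clipping keeps the bound \<open>K\<close> also on the null set where the
      subsequence diverges.\<close>
  define u where "u x = max (- K) (min K (lim (\<lambda>i. w (r i) x)))" for x
  have um: "u \<in> borel_measurable M"
    unfolding u_def using WM[OF wW] by measurable
  have ub: "\<bar>u x\<bar> \<le> K" for x
    using K by (auto simp: u_def)
  have ulim: "AE x in M. (\<lambda>i. w (r i) x) \<longlonglongrightarrow> u x"
    using cau AE_space
  proof (eventually_elim, goal_cases)
    case (1 x)
    then obtain l where l: "(\<lambda>i. w (r i) x) \<longlonglongrightarrow> l"
      using Cauchy_convergent convergent_def by blast
    have "\<bar>w (r i) x\<bar> \<le> K" for i
      using WK[OF wW 1(2)] .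
    then have "- K \<le> l" "l \<le> K"
      using LIMSEQ_le_const[OF l, of "- K"] LIMSEQ_le_const2[OF l, of K] by (auto simp: abs_le_iff minus_le_iff)
    then have "u x = l"
      using limI[OF l] by (simp add: u_def)
    with l show ?case by simp
  qed
  have "(\<integral>x. u x * \<psi> x \<partial>M) = L"
    if \<psi>: "integrable M \<psi>" and L: "(\<lambda>n. \<integral>x. v n x * \<psi> x \<partial>M) \<longlonglongrightarrow> L" for \<psi> L
  proof (rule LIMSEQ_unique)
    have "(\<lambda>n. \<integral>x. w n x * \<psi> x \<partial>M) \<longlonglongrightarrow> L"
    proof (rule LIMSEQ_I)
      fix e :: real assume "e > 0"
      then obtain N where N: "\<And>n. n \<ge> N \<Longrightarrow> \<bar>(\<integral>x. v n x * \<psi> x \<partial>M) - L\<bar> < e / 2"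
        using LIMSEQ_D[OF L, of "e/2"] by auto
      have "\<bar>(\<integral>x. w n x * \<psi> x \<partial>M) - L\<bar> \<le> e / 2" if "n \<ge> N" for n
        using that by (intro Wlim[OF wW[of n] \<psi>] less_imp_le[OF N]) auto
      then show "\<exists>no. \<forall>n\<ge>no. norm ((\<integral>x. w n x * \<psi> x \<partial>M) - L) < e"
        using \<open>e > 0\<close> by (intro exI[of _ N]) fastforce
    qed
    then show "(\<lambda>n. \<integral>x. w (r n) x * \<psi> x \<partial>M) \<longlonglongrightarrow> L"
      using LIMSEQ_subseq_LIMSEQ[OF _ r] by (auto simp: o_def)
    show "(\<lambda>n. \<integral>x. w (r n) x * \<psi> x \<partial>M) \<longlonglongrightarrow> (\<integral>x. u x * \<psi> x \<partial>M)"
    proof (rule integral_dominated_convergence[where w="\<lambda>x. K * \<bar>\<psi> x\<bar>"])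
      show "AE x in M. (\<lambda>i. w (r i) x * \<psi> x) \<longlonglongrightarrow> u x * \<psi> x"
        using ulim by eventually_elim (intro tendsto_intros)
      show "AE x in M. norm (w (r i) x * \<psi> x) \<le> K * \<bar>\<psi> x\<bar>" for i
        using WK[OF wW] by (intro AE_I2) (auto simp: abs_mult intro!: mult_right_mono)
      show "integrable M (\<lambda>x. K * \<bar>\<psi> x\<bar>)" using \<psi> by simp
    qed (use \<psi> um WM[OF wW] in measurable)
  qed
  with um ub show ?thesis using that by blast
qed

section \<open>Test functions and partial derivatives\<close>

lemma test_function_derivs:
  assumes "\<phi> \<in> test_functions \<Omega>"
  shows "partial_deriv i \<phi> \<in> test_functions \<Omega>"
proof -
  have "partial_derivs is (partial_deriv i \<phi>) = partial_derivs (is @ [i]) \<phi>" for "is"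
    by (simp add: partial_derivs_def)
  \<comment> \<open>On the open complement of its support \<open>\<phi>\<close> is constant, so its
      derivatives vanish there.\<close>
  moreover have sub: "closure {x. partial_deriv i \<phi> x \<noteq> 0} \<subseteq> closure {x. \<phi> x \<noteq> 0}"
  proof (rule closure_minimal)
    show "{x. partial_deriv i \<phi> x \<noteq> 0} \<subseteq> closure {x. \<phi> x \<noteq> 0}"
    proof (rule subsetI, rule ccontr)
      fix x assume x: "x \<in> {x. partial_deriv i \<phi> x \<noteq> 0}" "x \<notin> closure {x. \<phi> x \<noteq> 0}"
      have "0 = \<phi> y" if "y \<in> - closure {x. \<phi> x \<noteq> 0}" for y
        using that closure_subset[of "{x. \<phi> x \<noteq> 0}"] by auto
      then have "(\<phi> has_derivative (\<lambda>_. 0)) (at x)"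
        by (rule has_derivative_transform_within_open[OF has_derivative_const, where s="- closure {x. \<phi> x \<noteq> 0}", rotated 2])
           (use x(2) in \<open>simp_all add: open_Compl\<close>)
      then have "frechet_derivative \<phi> (at x) = (\<lambda>_. 0)"
        using frechet_derivative_at by metis
      with x(1) show False by (simp add: partial_deriv_def)
    qed
  qed simp
  moreover have "compact (closure {x. partial_deriv i \<phi> x \<noteq> 0})"
    using assms sub by (metis (mono_tags, lifting) closed_closure closed_Int_compact inf.absorb1 mem_Collect_eq test_functions_def)
  ultimately show ?thesis
    using assms by (auto simp: test_functions_def)
qed

lemma test_function_differentiable:
  assumes "\<phi> \<in> test_functions \<Omega>" shows "\<phi> differentiable (at x)"
  using assms by (auto simp: test_functions_def partial_derivs_def dest!: spec[of _ "[]"])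

lemma test_function_continuous:
  assumes "\<phi> \<in> test_functions \<Omega>" shows "continuous_on S \<phi>"
  using test_function_differentiable[OF assms]
  by (simp add: continuous_at_imp_continuous_on differentiable_imp_continuous_within)

lemma test_function_bounded:
  assumes "\<phi> \<in> test_functions \<Omega>"
  obtains B where "\<And>x. \<bar>\<phi> x\<bar> \<le> B"
proof -
  have "compact (\<phi> ` closure {x. \<phi> x \<noteq> 0})"
    using assms by (intro compact_continuous_image test_function_continuous) (auto simp: test_functions_def)
  then obtain B where B: "\<And>x. x \<in> closure {x. \<phi> x \<noteq> 0} \<Longrightarrow> \<bar>\<phi> x\<bar> \<le> B"
    by (meson bounded_real compact_imp_bounded imageI)
  have "\<bar>\<phi> x\<bar> \<le> max B 0" for x
    using B[of x] closure_subset[of "{x. \<phi> x \<noteq> 0}"] by (cases "\<phi> x = 0") auto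
  then show ?thesis using that by blast
qed

text \<open>
  The partial derivative is the ordinary derivative along a coordinate line, which gives access to
  difference quotients and to the mean value theorem.
\<close>

lemma partial_deriv_along_line:
  fixes f :: "real ^ 'm::finite \<Rightarrow> real"
  assumes "f differentiable (at (x + t *\<^sub>R axis i 1))"
  shows "((\<lambda>t. f (x + t *\<^sub>R axis i 1)) has_real_derivative partial_deriv i f (x + t *\<^sub>R axis i 1)) (at t)"
proof -
  define D where "D = frechet_derivative f (at (x + t *\<^sub>R axis i 1))"
  have D: "(f has_derivative D) (at (x + t *\<^sub>R axis i 1))"
    using assms by (simp add: D_def frechet_derivative_works)
  have "((\<lambda>t. x + t *\<^sub>R axis i 1) has_derivative (\<lambda>h. h *\<^sub>R axis i 1)) (at t)"
    by (auto intro!: derivative_eq_intros)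
  then have "((\<lambda>t. f (x + t *\<^sub>R axis i 1)) has_derivative (\<lambda>h. D (h *\<^sub>R axis i 1))) (at t)"
    using D by (rule has_derivative_compose)
  moreover have "D (h *\<^sub>R axis i 1) = partial_deriv i f (x + t *\<^sub>R axis i 1) * h" for h
    using linear_scale[OF has_derivative_linear[OF D], of h "axis i 1"]
    by (simp add: partial_deriv_def D_def)
  ultimately show ?thesis by (simp add: has_field_derivative_def)
qed

lemma difference_quotient_tendsto_partial_deriv:
  fixes f :: "real ^ 'm::finite \<Rightarrow> real"
  assumes "f differentiable (at x)" and h: "h \<longlonglongrightarrow> 0" "\<And>n. h n \<noteq> 0"
  shows "(\<lambda>n. (f (x + h n *\<^sub>R axis i 1) - f x) / h n) \<longlonglongrightarrow> partial_deriv i f x"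
proof -
  have "((\<lambda>t. f (x + t *\<^sub>R axis i 1)) has_real_derivative partial_deriv i f x) (at 0)"
    using partial_deriv_along_line[of f x 0 i] assms(1) by simp
  then have "((\<lambda>t. (f (x + t *\<^sub>R axis i 1) - f x) / t) \<longlongrightarrow> partial_deriv i f x) (at 0)"
    by (simp add: DERIV_def)
  then show ?thesis
    using h by (auto simp: tendsto_at_iff_sequentially o_def)
qed

lemma difference_quotient_bound:
  fixes f :: "real ^ 'm::finite \<Rightarrow> real"
  assumes "\<And>x. f differentiable (at x)" and B: "\<And>x. \<bar>partial_deriv i f x\<bar> \<le> B" 
  shows "\<bar>(f (x + h *\<^sub>R axis i 1) - f x) / h\<bar> \<le> B"
proof (cases "h = 0")
  case True
  then show ?thesis using B[of x] by (simp add: order_trans[OF abs_ge_zero])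
next
  case False
  have "\<bar>f (x + h *\<^sub>R axis i 1) - f (x + 0 *\<^sub>R axis i 1)\<bar> \<le> B * \<bar>h - 0\<bar>"
    by (rule field_differentiable_bound[of UNIV "\<lambda>t. f (x + t *\<^sub>R axis i 1)" 
          "\<lambda>t. partial_deriv i f (x + t *\<^sub>R axis i 1)", simplified real_norm_def])
       (auto intro!: partial_deriv_along_line assms)
  then show ?thesis using False by (simp add: field_simps abs_divide)
qed

section \<open>Difference quotients and integration by parts\<close>

text \<open>
  The value \<open>0\<close> where the shifted point leaves \<open>\<Omega>\<close> keeps the quotient bounded by the Lipschitz
  constant of \<open>g\<close> on all of \<open>\<Omega>\<close>.  It is harmless because a test function vanishes there as soon as
  \<open>h\<close> is small.
\<close>

definition diff_quot ::
  "(real ^ 'm::finite) set \<Rightarrow> real \<Rightarrow> 'm \<Rightarrow> (real ^ 'm \<Rightarrow> real) \<Rightarrow> real ^ 'm \<Rightarrow> real" where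
  "diff_quot \<Omega> h i g x =
     (if x \<in> \<Omega> \<and> x + h *\<^sub>R axis i 1 \<in> \<Omega> then (g (x + h *\<^sub>R axis i 1) - g x) / h else 0)"

lemma diff_quot_measurable:
  assumes "open \<Omega>" "continuous_on \<Omega> g"
  shows "diff_quot \<Omega> h i g \<in> borel_measurable borel"
proof -
  define G where "G x = indicator \<Omega> x *\<^sub>R g x" for x
  have [measurable]: "G \<in> borel_measurable borel"
    unfolding G_def using assms by (intro borel_measurable_continuous_on_indicator) auto
  have [measurable]: "\<Omega> \<in> sets borel" using assms by auto
  have "diff_quot \<Omega> h i g =
    (\<lambda>x. indicator \<Omega> x * indicator \<Omega> (x + h *\<^sub>R axis i 1) * ((G (x + h *\<^sub>R axis i 1) - G x) / h))"
    by (auto simp: diff_quot_def G_def fun_eq_iff)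
  also have "\<dots> \<in> borel_measurable borel" by measurable
  finally show ?thesis .
qed

lemma diff_quot_bound:
  assumes "C-lipschitz_on \<Omega> g"
  shows "\<bar>diff_quot \<Omega> h i g x\<bar> \<le> C"
proof -
  have "C \<ge> 0" using assms lipschitz_on_nonneg by blast
  moreover have "\<bar>(g (x + h *\<^sub>R axis i 1) - g x) / h\<bar> \<le> C"
    if "h \<noteq> 0" "x \<in> \<Omega>" "x + h *\<^sub>R axis i 1 \<in> \<Omega>"
    using lipschitz_onD[OF assms that(3,2)] that(1)
    by (simp add: dist_norm field_simps norm_axis_1)
  ultimately show ?thesis by (cases "h = 0") (auto simp: diff_quot_def)
qed

lemma borel_imp_lebesgue_on: 
  "f \<in> borel_measurable borel \<Longrightarrow> f \<in> borel_measurable (lebesgue_on \<Omega>)"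
  by (simp add: measurable_completion measurable_restrict_space1)

lemma finite_measure_lebesgue_on_bounded:
  fixes \<Omega> :: "'a::euclidean_space set"
  assumes "open \<Omega>" "bounded \<Omega>"
  shows "finite_measure (lebesgue_on \<Omega>)"
proof (rule finite_measureI)
  show "emeasure (lebesgue_on \<Omega>) (space (lebesgue_on \<Omega>)) \<noteq> \<infinity>"
    using assms emeasure_bounded_finite[of \<Omega>] by (simp add: emeasure_restrict_space)
qed

lemma integral_lborel_translation:
  fixes F :: "'a::euclidean_space \<Rightarrow> real"
  assumes [measurable]: "F \<in> borel_measurable borel"
  shows "(\<integral>x. F (c + x) \<partial>lborel) = (\<integral>x. F x \<partial>lborel)"
    and "integrable lborel (\<lambda>x. F (c + x)) \<longleftrightarrow> integrable lborel F"
  using integral_distr[of "(+) c" lborel borel F] integrable_distr_eq[of "(+) c" lborel borel F]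
  by (simp_all add: lborel_distr_plus)

lemma integral_lborel_shift_difference:
  fixes G \<phi> :: "'a::euclidean_space \<Rightarrow> real"
  assumes [measurable]: "G \<in> borel_measurable borel" "\<phi> \<in> borel_measurable borel"
    and i1: "integrable lborel (\<lambda>x. G x * \<phi> x)" and i2: "integrable lborel (\<lambda>x. G x * \<phi> (x - c))"
  shows "(\<integral>x. G (c + x) * \<phi> x - G x * \<phi> x \<partial>lborel) = (\<integral>x. G x * (\<phi> (x - c) - \<phi> x) \<partial>lborel)"
proof -
  define F where "F y = G y * \<phi> (y - c)" for y
  have [measurable]: "F \<in> borel_measurable borel" unfolding F_def by measurable
  have F: "G (c + x) * \<phi> x = F (c + x)" for x by (simp add: F_def)
  have iF: "integrable lborel F" using i2 by (simp add: F_def[abs_def])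
  then have iF2: "integrable lborel (\<lambda>x. F (c + x))"
    by (subst integral_lborel_translation(2)) auto
  have "(\<integral>x. G (c + x) * \<phi> x - G x * \<phi> x \<partial>lborel) = (\<integral>x. F (c + x) \<partial>lborel) - (\<integral>x. G x * \<phi> x \<partial>lborel)"
    unfolding F using iF2 i1 by (rule Bochner_Integration.integral_diff)
  also have "(\<integral>x. F (c + x) \<partial>lborel) = (\<integral>x. F x \<partial>lborel)"
    by (rule integral_lborel_translation(1)) measurable
  also have "(\<integral>x. F x \<partial>lborel) - (\<integral>x. G x * \<phi> x \<partial>lborel) = (\<integral>x. F x - G x * \<phi> x \<partial>lborel)"
    using iF i1 by (rule Bochner_Integration.integral_diff[symmetric])
  finally show ?thesis by (simp add: F_def right_diff_distrib)
qed

text \<open>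
  Once \<open>\<bar>h n\<bar>\<close> is below the distance \<open>d\<close> from the support of \<open>\<phi>\<close> to the complement of \<open>\<Omega>\<close>, translation
  invariance moves the difference quotient from \<open>g\<close> to \<open>\<phi>\<close>, with \<open>h\<close> replaced by \<open>- h\<close>.  The quotients
  of \<open>\<phi>\<close> are bounded by the supremum of its partial derivative, so dominated convergence applies.
\<close>

lemma diff_quot_by_parts:
  fixes g :: "real ^ 'm::finite \<Rightarrow> real"
  assumes \<Omega>: "open \<Omega>" "bounded \<Omega>" and g: "continuous_on \<Omega> g" "bounded (g ` \<Omega>)"
    and \<phi>: "\<phi> \<in> test_functions \<Omega>" and h: "h \<longlonglongrightarrow> 0" "\<And>n. h n \<noteq> 0"
  shows "(\<lambda>n. \<integral>x. diff_quot \<Omega> (h n) i g x * \<phi> x \<partial>lebesgue_on \<Omega>)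
    \<longlonglongrightarrow> - (\<integral>x. g x * partial_deriv i \<phi> x \<partial>lebesgue_on \<Omega>)"
proof -
  define e :: "real ^ 'm" where "e = axis i 1"
  \<comment> \<open>\<open>G\<close> extends \<open>g\<close> by zero, and \<open>q n\<close> is the
      difference quotient of \<open>\<phi>\<close> with step \<open>- h n\<close>.\<close>
  define G where "G x = indicator \<Omega> x * g x" for x
  define q where "q n x = (\<phi> (x + (- h n) *\<^sub>R e) - \<phi> x) / (- h n)" for n x
  have [measurable]: "\<Omega> \<in> sets borel" using \<Omega> by auto
  have G[measurable]: "G \<in> borel_measurable borel"
    unfolding G_def using borel_measurable_continuous_on_indicator[OF _ g(1)] by simp
  note d\<phi> = test_function_derivs[OF \<phi>, of i]
  have [measurable]: "\<phi> \<in> borel_measurable borel" "partial_deriv i \<phi> \<in> borel_measurable borel"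
    using test_function_continuous[OF \<phi>] test_function_continuous[OF d\<phi>]
    by (auto intro: borel_measurable_continuous_onI)
  have [measurable]: "q n \<in> borel_measurable borel" for n
    unfolding q_def by measurable
  obtain B where B: "\<And>x. \<bar>\<phi> x\<bar> \<le> B"
    using test_function_bounded[OF \<phi>] by blast
  obtain B' where B': "\<And>x. \<bar>partial_deriv i \<phi> x\<bar> \<le> B'"
    using test_function_bounded[OF d\<phi>] by blast
  have intG: "integrable lborel G"
  proof -
    obtain C where C: "\<And>x. x \<in> \<Omega> \<Longrightarrow> \<bar>g x\<bar> \<le> C"
      using g(2) by (auto simp: bounded_real)
    have "integrable lborel (\<lambda>x. C * indicator \<Omega> x)"
      using \<Omega> emeasure_bounded_finite[of \<Omega>] by (auto simp: integrable_indicator_iff)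
    then show ?thesis
    proof (rule Bochner_Integration.integrable_bound)
      show "AE x in lborel. norm (G x) \<le> norm (C * indicator \<Omega> x)"
        using C by (intro AE_I2) (fastforce simp: G_def indicator_def)
    qed auto
  qed
  have intGu: "integrable lborel (\<lambda>x. G x * u x)"
    if "u \<in> borel_measurable borel" "\<And>x. \<bar>u x\<bar> \<le> D" for u D
    using integrable_mult_bounded[OF intG, of u D] that by (simp add: mult.commute)
  have to_lborel: "(\<integral>x. F x \<partial>lebesgue_on \<Omega>) = (\<integral>x. H x \<partial>lborel)"
    if "H \<in> borel_measurable borel" "\<And>x. indicator \<Omega> x * F x = H x" for F H :: "real ^ 'm \<Rightarrow> real"
    using that integral_restrict_space[of \<Omega> lebesgue F] integral_completion[of H lborel] by simp
  define S where "S = closure {x. \<phi> x \<noteq> 0}"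
  have S: "compact S" "S \<subseteq> \<Omega>"
    using \<phi> by (auto simp: S_def test_functions_def)
  obtain d where d: "d > 0" "\<And>x y. x \<in> S \<Longrightarrow> y \<notin> \<Omega> \<Longrightarrow> d \<le> dist x y"
  proof -
    have "closed (- \<Omega>)" "S \<inter> - \<Omega> = {}"
      using S(2) \<Omega>(1) by auto
    from separate_compact_closed[OF S(1) this] that show ?thesis
      by blast
  qed
  have small: "\<forall>\<^sub>F n in sequentially. \<bar>h n\<bar> < d"
    by (rule order_tendstoD(2)[OF tendsto_rabs_zero[OF h(1)] d(1)])
  have eq: "(\<integral>x. diff_quot \<Omega> k i g x * \<phi> x \<partial>lebesgue_on \<Omega>) =
      (\<integral>x. G x * (\<phi> (x - k *\<^sub>R e) - \<phi> x) \<partial>lborel) / k" if k: "\<bar>k\<bar> < d" for k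
  proof -
    have 1: "indicator \<Omega> x * (diff_quot \<Omega> k i g x * \<phi> x) = (G (k *\<^sub>R e + x) * \<phi> x - G x * \<phi> x) / k" for x
    proof (cases "\<phi> x = 0")
      case False
      then have "x \<in> S"
        using closure_subset[of "{x. \<phi> x \<noteq> 0}"] by (auto simp: S_def)
      moreover have "dist x (x + k *\<^sub>R e) < d"
        using k by (simp add: dist_norm e_def norm_axis_1)
      ultimately have "x \<in> \<Omega>" "x + k *\<^sub>R e \<in> \<Omega>"
        using d(2)[of x "x + k *\<^sub>R e"] S(2) by force+
      then have "indicator \<Omega> x * (diff_quot \<Omega> k i g x * \<phi> x) = (g (x + k *\<^sub>R e) - g x) / k * \<phi> x"
        "G (k *\<^sub>R e + x) = g (x + k *\<^sub>R e)" "G x = g x"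
        by (simp_all add: diff_quot_def G_def e_def add.commute)
      then show ?thesis
        by (simp add: left_diff_distrib)
    qed simp
    have "(\<integral>x. diff_quot \<Omega> k i g x * \<phi> x \<partial>lebesgue_on \<Omega>) =
        (\<integral>x. (G (k *\<^sub>R e + x) * \<phi> x - G x * \<phi> x) / k \<partial>lborel)"
    proof (rule to_lborel[OF _ 1])
      show "(\<lambda>x. (G (k *\<^sub>R e + x) * \<phi> x - G x * \<phi> x) / k) \<in> borel_measurable borel"
        by measurable
    qed
    also have "\<dots> = (\<integral>x. G (k *\<^sub>R e + x) * \<phi> x - G x * \<phi> x \<partial>lborel) / k"
      by (rule integral_divide_zero)
    also have "(\<integral>x. G (k *\<^sub>R e + x) * \<phi> x - G x * \<phi> x \<partial>lborel) =
        (\<integral>x. G x * (\<phi> (x - k *\<^sub>R e) - \<phi> x) \<partial>lborel)"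
    proof (rule integral_lborel_shift_difference)
      show "integrable lborel (\<lambda>x. G x * \<phi> x)" by (rule intGu[OF _ B]) measurable
      show "integrable lborel (\<lambda>x. G x * \<phi> (x - k *\<^sub>R e))" by (rule intGu[OF _ B]) measurable
    qed measurable
    finally show ?thesis .
  qed
  have ev: "\<forall>\<^sub>F n in sequentially. (\<integral>x. - (G x * q n x) \<partial>lborel) =
    (\<integral>x. diff_quot \<Omega> (h n) i g x * \<phi> x \<partial>lebesgue_on \<Omega>)"
    using small
  proof (rule eventually_mono)
    fix n assume "\<bar>h n\<bar> < d"
    from eq[OF this] have "(\<integral>x. diff_quot \<Omega> (h n) i g x * \<phi> x \<partial>lebesgue_on \<Omega>) =
      (\<integral>x. G x * (\<phi> (x - h n *\<^sub>R e) - \<phi> x) / h n \<partial>lborel)"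
      by (simp only: integral_divide_zero)
    also have "\<dots> = (\<integral>x. - (G x * q n x) \<partial>lborel)"
      by (intro Bochner_Integration.integral_cong refl) (simp add: q_def)
    finally show "(\<integral>x. - (G x * q n x) \<partial>lborel) =
      (\<integral>x. diff_quot \<Omega> (h n) i g x * \<phi> x \<partial>lebesgue_on \<Omega>)" ..
  qed
  have "(\<lambda>n. \<integral>x. - (G x * q n x) \<partial>lborel) \<longlonglongrightarrow> (\<integral>x. - (G x * partial_deriv i \<phi> x) \<partial>lborel)"
  proof (rule integral_dominated_convergence[where w="\<lambda>x. \<bar>G x\<bar> * B'"])
    show "integrable lborel (\<lambda>x. \<bar>G x\<bar> * B')" using intG by auto
    have "(\<lambda>n. q n x) \<longlonglongrightarrow> partial_deriv i \<phi> x" for x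
      unfolding q_def e_def
      using h tendsto_minus[OF h(1)]
      by (intro difference_quotient_tendsto_partial_deriv test_function_differentiable[OF \<phi>]) auto
    then show "AE x in lborel. (\<lambda>n. - (G x * q n x)) \<longlonglongrightarrow> - (G x * partial_deriv i \<phi> x)"
      by (intro AE_I2 tendsto_intros)
    have "\<bar>q n x\<bar> \<le> B'" for n x
      unfolding q_def e_def
      by (intro difference_quotient_bound test_function_differentiable[OF \<phi>] B')
    then show "AE x in lborel. norm (- (G x * q n x)) \<le> \<bar>G x\<bar> * B'" for n
      by (intro AE_I2) (simp add: abs_mult mult_left_mono)
  qed measurable
  also have "(\<integral>x. - (G x * partial_deriv i \<phi> x) \<partial>lborel) = - (\<integral>x. G x * partial_deriv i \<phi> x \<partial>lborel)"
    by (rule integral_minus)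
  also have "(\<integral>x. G x * partial_deriv i \<phi> x \<partial>lborel) = (\<integral>x. g x * partial_deriv i \<phi> x \<partial>lebesgue_on \<Omega>)"
  proof (rule to_lborel[symmetric])
    show "(\<lambda>x. G x * partial_deriv i \<phi> x) \<in> borel_measurable borel" by measurable
    show "indicator \<Omega> x * (g x * partial_deriv i \<phi> x) = G x * partial_deriv i \<phi> x" for x
      by (simp only: G_def mult.assoc)
  qed
  finally show ?thesis
    by (rule Lim_transform_eventually[OF _ ev])
qed

section \<open>Bounded weak derivatives of Lipschitz functions\<close>

lemma bounded_imp_locally_integrable:
  assumes "open \<Omega>" and u: "u \<in> borel_measurable (lebesgue_on \<Omega>)" and C: "\<And>x. x \<in> \<Omega> \<Longrightarrow> \<bar>u x\<bar> \<le> C"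
  shows "locally_integrable_on u \<Omega>"
  unfolding locally_integrable_on_def
proof (intro allI impI)
  fix K assume K: "compact K \<and> K \<subseteq> \<Omega>"
  have "integrable lebesgue (\<lambda>x. (if x \<in> \<Omega> then u x else 0) * indicator K x)"
  proof (rule integrable_mult_bounded[where K="max C 0"])
    show "integrable lebesgue (indicator K :: _ \<Rightarrow> real)"
      using K emeasure_compact_finite[of K] by (auto simp: integrable_indicator_iff borel_compact)
    show "(\<lambda>x. if x \<in> \<Omega> then u x else 0) \<in> borel_measurable lebesgue"
      using u assms(1) by (intro borel_measurable_if_I) auto
  qed (use C in \<open>auto simp: le_max_iff_disj\<close>)
  also have "(\<lambda>x. (if x \<in> \<Omega> then u x else 0) * indicator K x) = (\<lambda>x. indicator K x *\<^sub>R u x)"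
    using K by (auto simp: fun_eq_iff indicator_def)
  finally show "set_integrable lebesgue K u" by (simp add: set_integrable_def)
qed

lemma integrable_lebesgue_on_test_function:
  assumes "open \<Omega>" "bounded \<Omega>" and \<phi>: "\<phi> \<in> test_functions \<Omega>"
  shows "integrable (lebesgue_on \<Omega>) \<phi>"
proof -
  interpret finite_measure "lebesgue_on \<Omega>"
    by (rule finite_measure_lebesgue_on_bounded[OF assms(1,2)])
  obtain B where B: "\<And>x. \<bar>\<phi> x\<bar> \<le> B"
    using test_function_bounded[OF \<phi>] by blast
  have "\<phi> \<in> borel_measurable (lebesgue_on \<Omega>)"
    using test_function_continuous[OF \<phi>] by (intro borel_imp_lebesgue_on borel_measurable_continuous_onI)
  with B show ?thesis
    by (intro integrable_const_bound[of _ B]) auto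
qed

lemma lipschitz_on_bounded_image:
  fixes g :: "'a::heine_borel \<Rightarrow> 'b::heine_borel"
  assumes "C-lipschitz_on \<Omega> g" "bounded \<Omega>" shows "bounded (g ` \<Omega>)"
  using bounded_uniformly_continuous_image[OF lipschitz_on_uniformly_continuous[OF assms(1)] assms(2)] .

text \<open>
  The weak limit point of the difference quotients is the weak derivative, since
  \<open>diff_quot_by_parts\<close> makes their integrals against every test function converge.
\<close>

lemma lipschitz_has_weak_deriv:
  fixes g :: "real ^ 'm::finite \<Rightarrow> real"
  assumes \<Omega>: "open \<Omega>" "bounded \<Omega>" and g: "C-lipschitz_on \<Omega> g"
  obtains v where "v \<in> borel_measurable (lebesgue_on \<Omega>)" "\<And>x. \<bar>v x\<bar> \<le> C" "has_weak_deriv \<Omega> [i] g v"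
proof -
  interpret finite_measure "lebesgue_on \<Omega>"
    by (rule finite_measure_lebesgue_on_bounded[OF \<Omega>])
  have gc: "continuous_on \<Omega> g" and gb: "bounded (g ` \<Omega>)"
    using lipschitz_on_continuous_on[OF g] lipschitz_on_bounded_image[OF g \<Omega>(2)] .
  define h where "h n = inverse (real (Suc n))" for n
  have h: "h \<longlonglongrightarrow> 0" "\<And>n. h n \<noteq> 0"
    unfolding h_def by (rule LIMSEQ_inverse_real_of_nat) simp
  obtain v where v: "v \<in> borel_measurable (lebesgue_on \<Omega>)" "\<And>x. \<bar>v x\<bar> \<le> C"
    and lim: "\<And>\<psi> L. integrable (lebesgue_on \<Omega>) \<psi> \<Longrightarrow>
      (\<lambda>n. \<integral>x. diff_quot \<Omega> (h n) i g x * \<psi> x \<partial>lebesgue_on \<Omega>) \<longlonglongrightarrow> L \<Longrightarrow>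
      (\<integral>x. v x * \<psi> x \<partial>lebesgue_on \<Omega>) = L"
    by (rule bounded_sequence_weak_limit[of "\<lambda>n. diff_quot \<Omega> (h n) i g" C,
          OF borel_imp_lebesgue_on[OF diff_quot_measurable[OF \<Omega>(1) gc]]
             diff_quot_bound[OF g] lipschitz_on_nonneg[OF g]]) (rule that)
  have "has_weak_deriv \<Omega> [i] g v"
    unfolding has_weak_deriv_def
  proof (intro conjI ballI)
    obtain B where B: "\<And>x. x \<in> \<Omega> \<Longrightarrow> \<bar>g x\<bar> \<le> B"
      using gb unfolding bounded_real by fast
    have mg: "g \<in> borel_measurable (lebesgue_on \<Omega>)"
      using gc \<Omega> by (intro continuous_imp_measurable_on_sets_lebesgue) auto
    show "locally_integrable_on g \<Omega>"
      by (rule bounded_imp_locally_integrable[OF \<Omega>(1) mg B])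
    show "locally_integrable_on v \<Omega>"
      by (rule bounded_imp_locally_integrable[OF \<Omega>(1) v])
    fix \<phi> assume \<phi>: "\<phi> \<in> test_functions \<Omega>"
    show "(\<integral>x. g x * partial_derivs [i] \<phi> x \<partial>lebesgue_on \<Omega>) =
        (- 1) ^ length [i] * (\<integral>x. v x * \<phi> x \<partial>lebesgue_on \<Omega>)"
      using lim[OF integrable_lebesgue_on_test_function[OF \<Omega> \<phi>] diff_quot_by_parts[OF \<Omega> gc gb \<phi> h]]
      by (simp add: partial_derivs_def)
  qed
  from that[OF v this] show ?thesis .
qed

lemma diff_quot_tendsto_partial_deriv:
  fixes g :: "real ^ 'm::finite \<Rightarrow> real"
  assumes "open \<Omega>" "x \<in> \<Omega>" "g differentiable (at x)" and h: "h \<longlonglongrightarrow> 0" "\<And>n. h n \<noteq> 0"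
  shows "(\<lambda>n. diff_quot \<Omega> (h n) i g x) \<longlonglongrightarrow> partial_deriv i g x"
proof -
  have "(\<lambda>n. x + h n *\<^sub>R axis i 1) \<longlonglongrightarrow> x"
    using tendsto_add[OF tendsto_const[of x] tendsto_scaleR[OF h(1) tendsto_const[of "axis i 1"]]] by simp
  then have "\<forall>\<^sub>F n in sequentially. x + h n *\<^sub>R axis i 1 \<in> \<Omega>"
    using assms(1,2) by (rule topological_tendstoD)
  then have "\<forall>\<^sub>F n in sequentially. diff_quot \<Omega> (h n) i g x = (g (x + h n *\<^sub>R axis i 1) - g x) / h n"
    by eventually_elim (simp add: diff_quot_def assms(2))
  then show ?thesis
    using difference_quotient_tendsto_partial_deriv[OF assms(3) h] by (simp add: tendsto_cong)
qed

text \<open>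
  Here the difference quotients converge pointwise, and their limit is measurable for that reason
  and inherits their bound.
\<close>

lemma differentiable_lipschitz_has_weak_deriv:
  fixes f :: "real ^ 'm::finite \<Rightarrow> real"
  assumes \<Omega>: "open \<Omega>" "bounded \<Omega>" and f: "C-lipschitz_on \<Omega> f" "\<And>x. x \<in> \<Omega> \<Longrightarrow> f differentiable (at x)"
  shows "partial_deriv i f \<in> borel_measurable (lebesgue_on \<Omega>)"
    and "\<And>x. x \<in> \<Omega> \<Longrightarrow> \<bar>partial_deriv i f x\<bar> \<le> C"
    and "has_weak_deriv \<Omega> [i] f (partial_deriv i f)"
proof -
  have fc: "continuous_on \<Omega> f" and fb: "bounded (f ` \<Omega>)"
    using lipschitz_on_continuous_on[OF f(1)] lipschitz_on_bounded_image[OF f(1) \<Omega>(2)] .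
  define h where "h n = inverse (real (Suc n))" for n
  have h: "h \<longlonglongrightarrow> 0" "\<And>n. h n \<noteq> 0"
    unfolding h_def by (rule LIMSEQ_inverse_real_of_nat) simp
  note lim = diff_quot_tendsto_partial_deriv[OF \<Omega>(1) _ f(2) h, of _ i]
  note meas = borel_imp_lebesgue_on[OF diff_quot_measurable[OF \<Omega>(1) fc]]
  show m: "partial_deriv i f \<in> borel_measurable (lebesgue_on \<Omega>)"
    by (rule borel_measurable_LIMSEQ_real[OF lim meas]) auto
  show b: "\<bar>partial_deriv i f x\<bar> \<le> C" if "x \<in> \<Omega>" for x
    by (rule LIMSEQ_le_const2[OF tendsto_rabs[OF lim[OF that that]]]) (simp add: diff_quot_bound[OF f(1)])
  show "has_weak_deriv \<Omega> [i] f (partial_deriv i f)"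
    unfolding has_weak_deriv_def
  proof (intro conjI ballI)
    obtain B where B: "\<And>x. x \<in> \<Omega> \<Longrightarrow> \<bar>f x\<bar> \<le> B"
      using fb unfolding bounded_real by fast
    have mf: "f \<in> borel_measurable (lebesgue_on \<Omega>)"
      using fc \<Omega> by (intro continuous_imp_measurable_on_sets_lebesgue) auto
    show "locally_integrable_on f \<Omega>"
      by (rule bounded_imp_locally_integrable[OF \<Omega>(1) mf B])
    show "locally_integrable_on (partial_deriv i f) \<Omega>"
      by (rule bounded_imp_locally_integrable[OF \<Omega>(1) m b])
    fix \<phi> assume \<phi>: "\<phi> \<in> test_functions \<Omega>"
    have i\<phi>: "integrable (lebesgue_on \<Omega>) \<phi>"
      by (rule integrable_lebesgue_on_test_function[OF \<Omega> \<phi>])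
    have "(\<lambda>n. \<integral>x. diff_quot \<Omega> (h n) i f x * \<phi> x \<partial>lebesgue_on \<Omega>)
        \<longlonglongrightarrow> (\<integral>x. partial_deriv i f x * \<phi> x \<partial>lebesgue_on \<Omega>)"
    proof (rule integral_dominated_convergence[where w="\<lambda>x. C * \<bar>\<phi> x\<bar>"])
      show "AE x in lebesgue_on \<Omega>. (\<lambda>n. diff_quot \<Omega> (h n) i f x * \<phi> x) \<longlonglongrightarrow> partial_deriv i f x * \<phi> x"
      proof (rule AE_I2)
        fix x assume "x \<in> space (lebesgue_on \<Omega>)"
        then have "x \<in> \<Omega>" by simp
        from tendsto_mult[OF lim[OF this this] tendsto_const]
        show "(\<lambda>n. diff_quot \<Omega> (h n) i f x * \<phi> x) \<longlonglongrightarrow> partial_deriv i f x * \<phi> x" .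
      qed
      show "AE x in lebesgue_on \<Omega>. norm (diff_quot \<Omega> (h n) i f x * \<phi> x) \<le> C * \<bar>\<phi> x\<bar>" for n
        using diff_quot_bound[OF f(1)] by (intro AE_I2) (simp add: abs_mult mult_right_mono)
      show "integrable (lebesgue_on \<Omega>) (\<lambda>x. C * \<bar>\<phi> x\<bar>)" using i\<phi> by simp
      show "(\<lambda>x. partial_deriv i f x * \<phi> x) \<in> borel_measurable (lebesgue_on \<Omega>)"
        using m borel_measurable_integrable[OF i\<phi>] by (rule borel_measurable_times)
      show "(\<lambda>x. diff_quot \<Omega> (h n) i f x * \<phi> x) \<in> borel_measurable (lebesgue_on \<Omega>)" for n
        using meas borel_measurable_integrable[OF i\<phi>] by (rule borel_measurable_times)
    qed
    from LIMSEQ_unique[OF this diff_quot_by_parts[OF \<Omega> fc fb \<phi> h]]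
    show "(\<integral>x. f x * partial_derivs [i] \<phi> x \<partial>lebesgue_on \<Omega>) =
        (- 1) ^ length [i] * (\<integral>x. partial_deriv i f x * \<phi> x \<partial>lebesgue_on \<Omega>)"
      by (simp add: partial_derivs_def)
  qed
qed

lemma has_weak_deriv_compose:
  assumes "has_weak_deriv \<Omega> [i] f g" "has_weak_deriv \<Omega> [j] g v"
  shows "has_weak_deriv \<Omega> [i, j] f v"
  unfolding has_weak_deriv_def
proof (intro conjI ballI)
  show "locally_integrable_on f \<Omega>" "locally_integrable_on v \<Omega>"
    using assms unfolding has_weak_deriv_def by blast+
  fix \<phi> assume \<phi>: "\<phi> \<in> test_functions \<Omega>"
  have "(\<integral>x. f x * partial_derivs [i, j] \<phi> x \<partial>lebesgue_on \<Omega>)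
      = (\<integral>x. f x * partial_derivs [i] (partial_deriv j \<phi>) x \<partial>lebesgue_on \<Omega>)"
    by (simp add: partial_derivs_def)
  also have "\<dots> = (- 1) ^ length [i] * (\<integral>x. g x * partial_derivs [j] \<phi> x \<partial>lebesgue_on \<Omega>)"
    using assms(1) test_function_derivs[OF \<phi>, of j]
    unfolding has_weak_deriv_def by (auto simp: partial_derivs_def)
  also have "(\<integral>x. g x * partial_derivs [j] \<phi> x \<partial>lebesgue_on \<Omega>)
      = (- 1) ^ length [j] * (\<integral>x. v x * \<phi> x \<partial>lebesgue_on \<Omega>)"
    using assms(2) \<phi> unfolding has_weak_deriv_def by blast
  finally show "(\<integral>x. f x * partial_derivs [i, j] \<phi> x \<partial>lebesgue_on \<Omega>)
      = (- 1) ^ length [i, j] * (\<integral>x. v x * \<phi> x \<partial>lebesgue_on \<Omega>)"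
    by simp
qed

lemma Linf_norm_le:
  assumes "u \<in> borel_measurable (lebesgue_on \<Omega>)" "\<And>x. x \<in> \<Omega> \<Longrightarrow> \<bar>u x\<bar> \<le> C"
  shows "Linf_norm \<Omega> u \<le> ennreal C"
  unfolding Linf_norm_def using assms by (intro esssup_I AE_I2) (auto intro: ennreal_leI)

text \<open>
  Orders zero and one are covered by \<open>f\<close> and its classical derivatives; order two uses that each
  classical partial derivative, being Lipschitz, has bounded weak derivatives.
\<close>

lemma C11_imp_sobolev_inf_2:
  fixes f :: "real ^ 'm::finite \<Rightarrow> real"
  assumes \<Omega>: "open \<Omega>" "bounded \<Omega>"
    and fM: "\<And>x. x \<in> \<Omega> \<Longrightarrow> \<bar>f x\<bar> \<le> M" and f: "M-lipschitz_on \<Omega> f"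
    and df: "\<And>x. x \<in> \<Omega> \<Longrightarrow> f differentiable (at x)"
    and ddf: "\<And>i. M-lipschitz_on \<Omega> (partial_deriv i f)"
  shows "f \<in> sobolev_inf 2 \<Omega>" "sobolev_inf_norm 2 \<Omega> f \<le> ennreal M"
proof -
  have fm: "f \<in> borel_measurable (lebesgue_on \<Omega>)"
    using lipschitz_on_continuous_on[OF f] \<Omega> by (intro continuous_imp_measurable_on_sets_lebesgue) auto
  have ex: "\<exists>v \<in> borel_measurable (lebesgue_on \<Omega>). (\<forall>x\<in>\<Omega>. \<bar>v x\<bar> \<le> M) \<and> has_weak_deriv \<Omega> is f v"
    if len: "length is \<le> 2" for "is"
  proof -
    consider "is = []" | i where "is = [i]" | i j where "is = [i, j]"
    proof (cases "is")
      case (Cons i js)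
      then show ?thesis
        using len that(2,3) by (cases js) auto
    qed (use that(1) in auto)
    then show ?thesis
    proof cases
      case 1
      have "has_weak_deriv \<Omega> is f f"
        using bounded_imp_locally_integrable[OF \<Omega>(1) fm fM]
        by (simp add: has_weak_deriv_def 1 partial_derivs_def)
      with fm fM show ?thesis by blast
    next
      case 2
      then show ?thesis
        by (intro bexI[of _ "partial_deriv i f"])
          (simp_all add: differentiable_lipschitz_has_weak_deriv[OF \<Omega> f df])
    next
      case 3
      obtain v where v: "v \<in> borel_measurable (lebesgue_on \<Omega>)" "\<And>x. \<bar>v x\<bar> \<le> M"
        "has_weak_deriv \<Omega> [j] (partial_deriv i f) v"
        by (rule lipschitz_has_weak_deriv[OF \<Omega> ddf, of j i]) (rule that)
      then show ?thesis
        using has_weak_deriv_compose[OF differentiable_lipschitz_has_weak_deriv(3)[OF \<Omega> f df] v(3)]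
        by (intro bexI[of _ v]) (simp_all add: 3)
    qed
  qed
  have bd: "v \<in> Linf \<Omega>" if "v \<in> borel_measurable (lebesgue_on \<Omega>)" "\<forall>x\<in>\<Omega>. \<bar>v x\<bar> \<le> M" for v
    using that Linf_norm_le[of v \<Omega> M] by (auto simp: Linf_def intro: le_less_trans)
  show "f \<in> sobolev_inf 2 \<Omega>"
    unfolding sobolev_inf_def
  proof (intro CollectI conjI allI impI)
    show "f \<in> Linf \<Omega>"
      using bd fm fM by simp
    fix "is" :: "'m list" assume "length is \<le> 2"
    from ex[OF this] show "\<exists>v \<in> Linf \<Omega>. has_weak_deriv \<Omega> is f v"
      using bd by auto
  qed
  show "sobolev_inf_norm 2 \<Omega> f \<le> ennreal M"
    unfolding sobolev_inf_norm_def
  proof (rule SUP_least)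
    fix "is" :: "'m list" assume "is \<in> {is. length is \<le> 2}"
    then obtain v where "v \<in> borel_measurable (lebesgue_on \<Omega>)" "\<forall>x\<in>\<Omega>. \<bar>v x\<bar> \<le> M" "has_weak_deriv \<Omega> is f v"
      using ex[of "is"] by auto
    then show "(INF v \<in> {v. has_weak_deriv \<Omega> is f v}. Linf_norm \<Omega> v) \<le> ennreal M"
      using Linf_norm_le[of v \<Omega> M] by (intro INF_lower2[of v]) auto
  qed
qed

section \<open>Geometry of tangent balls\<close>

text \<open>
  The tangent balls at \<open>p\<close> are encoded by one unit vector instead of two centres;
  \<open>tangent_balls_outer_normal\<close> shows that this loses nothing.
\<close>

definition outer_normal :: "real \<Rightarrow> (real ^ 'n::finite) set \<Rightarrow> real ^ 'n \<Rightarrow> real ^ 'n \<Rightarrow> bool" where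
  "outer_normal R E p \<nu> \<longleftrightarrow>
     \<nu> \<bullet> \<nu> = 1 \<and> ball (p - R *\<^sub>R \<nu>) R \<subseteq> E \<and> ball (p + R *\<^sub>R \<nu>) R \<inter> E = {}"

lemma dist_centres_of_disjoint_balls:
  fixes a b :: "'a::euclidean_space"
  assumes "ball a R \<inter> ball b R = {}" "R > 0"
  shows "4 * R\<^sup>2 \<le> (a - b) \<bullet> (a - b)"
proof (rule ccontr)
  assume *: "\<not> 4 * R\<^sup>2 \<le> (a - b) \<bullet> (a - b)"
  then have "(norm (a - b))\<^sup>2 < (2 * R)\<^sup>2"
    by (simp add: power2_norm_eq_inner power_mult_distrib)
  then have "norm (a - b) < 2 * R"
    by (rule power2_less_imp_less) (use assms(2) in simp)
  then have "dist a b < 2 * R"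
    by (simp add: dist_norm)
  then have "midpoint a b \<in> ball a R \<inter> ball b R"
    by (simp add: dist_midpoint)
  with assms(1) show False by auto
qed

text \<open>
  The two centres are at distance \<open>R\<close> from \<open>p\<close> and at least \<open>2 R\<close> apart.  By strict convexity of the
  Euclidean norm this forces \<open>p\<close> to be their midpoint.
\<close>

lemma tangent_balls_outer_normal:
  fixes p :: "real ^ 'n::finite"
  assumes T: "tangent_balls R E p p' p''" and R: "R > 0"
  shows "outer_normal R E p ((1 / (2 * R)) *\<^sub>R (p'' - p'))"
proof -
  have d: "dist p' p = R" "dist p'' p = R" and sub: "ball p' R \<subseteq> E" "ball p'' R \<inter> E = {}"
    using T R by (auto simp: tangent_balls_def frontier_ball)
  define a b where "a = p - p'" and "b = p'' - p"
  have ab: "a \<bullet> a = R\<^sup>2" "b \<bullet> b = R\<^sup>2"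
    using d by (simp_all add: a_def b_def dist_norm norm_minus_commute flip: power2_norm_eq_inner)
  have "ball p'' R \<inter> ball p' R = {}" using sub by auto
  from dist_centres_of_disjoint_balls[OF this R]
  have "4 * R\<^sup>2 \<le> (a + b) \<bullet> (a + b)"
    by (simp add: a_def b_def)
  then have "(a - b) \<bullet> (a - b) \<le> 0"
    using ab by (simp add: inner_simps inner_commute)
  then have "a = b" by (metis inner_eq_zero_iff inner_ge_zero antisym right_minus_eq)
  have "p'' - p' = a + b"
    by (simp add: a_def b_def)
  also have "\<dots> = 2 *\<^sub>R a"
    using \<open>a = b\<close> by (simp add: scaleR_2)
  finally have "p'' - p' = 2 *\<^sub>R a" .
  then have \<nu>: "(1 / (2 * R)) *\<^sub>R (p'' - p') = (1 / R) *\<^sub>R a"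
    by simp
  have "R *\<^sub>R ((1 / R) *\<^sub>R a) = a" using R by simp
  moreover have "p' = p - a" "p'' = p + a"
    using \<open>a = b\<close> by (simp_all add: a_def b_def)
  ultimately show ?thesis
    unfolding outer_normal_def \<nu> using sub ab R
    by (simp add: power2_eq_square)
qed

text \<open>
  A boundary point lies outside both open tangent balls at \<open>p\<close>: the interior one is contained in the
  interior of \<open>E\<close>, and the exterior one misses \<open>E\<close>, to which the point belongs.  Expanding the squared
  distances to the two centres gives the two signs of the estimate.
\<close>

lemma outer_normal_quadratic:
  fixes p q :: "real ^ 'n::finite"
  assumes N: "outer_normal R E p \<nu>" and E: "closed E" and q: "q \<in> frontier E" and R: "R > 0"
  shows "\<bar>\<nu> \<bullet> (q - p)\<bar> \<le> ((q - p) \<bullet> (q - p)) / (2 * R)"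
proof -
  have far: "R\<^sup>2 \<le> (c - q) \<bullet> (c - q)" if "q \<notin> ball c R" for c
  proof -
    have "R \<le> norm (c - q)" using that by (simp add: dist_norm)
    then have "R\<^sup>2 \<le> (norm (c - q))\<^sup>2" using R by (intro power_mono) auto
    then show ?thesis by (simp add: power2_norm_eq_inner)
  qed
  have "ball (p - R *\<^sub>R \<nu>) R \<subseteq> interior E"
    using N by (simp add: outer_normal_def interior_maximal)
  then have "q \<notin> ball (p - R *\<^sub>R \<nu>) R" "q \<notin> ball (p + R *\<^sub>R \<nu>) R"
    using N q E frontier_subset_closed[OF E] by (auto simp: outer_normal_def frontier_def)
  from this[THEN far] have "0 \<le> (q - p) \<bullet> (q - p) + 2 * R * (\<nu> \<bullet> (q - p))"
      "0 \<le> (q - p) \<bullet> (q - p) - 2 * R * (\<nu> \<bullet> (q - p))"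
    using N by (simp_all add: outer_normal_def inner_simps inner_commute algebra_simps power2_eq_square)
  then have "\<bar>\<nu> \<bullet> (q - p)\<bar> * (2 * R) \<le> (q - p) \<bullet> (q - p)"
    by (auto simp: abs_if algebra_simps)
  then show ?thesis using R by (simp add: pos_le_divide_eq)
qed

text \<open>
  The interior ball at \<open>p\<close> and the exterior ball at \<open>q\<close> are disjoint, and so are the exterior ball
  at \<open>p\<close> and the interior ball at \<open>q\<close>.  Adding the two resulting lower bounds on the distances of the
  centres cancels the mixed terms and leaves \<open>4 R\<^sup>2 \<le> \<bar>p - q\<bar>\<^sup>2 + R\<^sup>2 \<bar>\<nu> + \<mu>\<bar>\<^sup>2\<close>, where
  \<open>\<bar>\<nu> + \<mu>\<bar>\<^sup>2 = 4 - \<bar>\<nu> - \<mu>\<bar>\<^sup>2\<close>.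
\<close>

lemma outer_normal_lipschitz:
  fixes p q :: "real ^ 'n::finite"
  assumes p: "outer_normal R E p \<nu>" and q: "outer_normal R E q \<mu>" and R: "R > 0"
  shows "norm (\<nu> - \<mu>) \<le> norm (p - q) / R"
proof -
  define d s where "d = p - q" and "s = \<nu> + \<mu>"
  have "ball (p - R *\<^sub>R \<nu>) R \<inter> ball (q + R *\<^sub>R \<mu>) R = {}" "ball (p + R *\<^sub>R \<nu>) R \<inter> ball (q - R *\<^sub>R \<mu>) R = {}"
    using p q by (auto simp: outer_normal_def)
  from this[THEN dist_centres_of_disjoint_balls[OF _ R]]
  have "4 * R\<^sup>2 \<le> (d - R *\<^sub>R s) \<bullet> (d - R *\<^sub>R s)" "4 * R\<^sup>2 \<le> (d + R *\<^sub>R s) \<bullet> (d + R *\<^sub>R s)"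
    by (simp_all add: d_def s_def algebra_simps)
  then have "4 * R\<^sup>2 \<le> d \<bullet> d + R\<^sup>2 * (s \<bullet> s)"
    by (simp add: inner_simps inner_commute power2_eq_square)
  moreover have "s \<bullet> s = 4 - (\<nu> - \<mu>) \<bullet> (\<nu> - \<mu>)"
    using p q by (simp add: s_def outer_normal_def inner_simps inner_commute)
  ultimately have "R\<^sup>2 * ((\<nu> - \<mu>) \<bullet> (\<nu> - \<mu>)) \<le> d \<bullet> d"
    by (simp add: algebra_simps)
  then have "(R * norm (\<nu> - \<mu>))\<^sup>2 \<le> (norm d)\<^sup>2"
    by (simp add: power_mult_distrib power2_norm_eq_inner)
  then have "R * norm (\<nu> - \<mu>) \<le> norm d"
    by (rule power2_le_imp_le) simp
  then show ?thesis using R by (simp add: d_def field_simps)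
qed

lemma outer_normal_exists:
  fixes E :: "(real ^ 'n::finite) set"
  assumes "E \<in> ball_class R" "p \<in> frontier E" "R > 0"
  obtains \<nu> where "outer_normal R E p \<nu>"
  using assms tangent_balls_outer_normal unfolding ball_class_def by blast

section \<open>The boundary in adapted coordinates\<close>

definition frame_comb :: "('m::finite \<Rightarrow> real ^ 'n::finite) \<Rightarrow> real ^ 'm \<Rightarrow> real ^ 'n" where
  "frame_comb e x = (\<Sum>i\<in>UNIV. (x $ i) *\<^sub>R e i)"

lemma from_coords_eq: "from_coords p (e, \<nu>) (x, z) = p + frame_comb e x + z *\<^sub>R \<nu>"
  by (simp add: from_coords_def frame_comb_def)

lemma linear_frame_comb: "linear (frame_comb e)"
  by (rule linearI) (simp_all add: frame_comb_def scaleR_left_distrib sum.distrib scaleR_sum_right)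

lemma frame_comb_axis [simp]: "frame_comb e (axis i 1) = e i"
proof -
  have "frame_comb e (axis i 1) = (\<Sum>j\<in>UNIV. if j = i then e j else 0)"
    unfolding frame_comb_def by (rule sum.cong) (auto simp: axis_def)
  then show ?thesis by simp
qed

lemma inner_frame_comb:
  assumes "orthonormal_frame (e, \<nu>)"
  shows "frame_comb e x \<bullet> frame_comb e y = x \<bullet> y" "frame_comb e x \<bullet> \<nu> = 0" "\<nu> \<bullet> frame_comb e x = 0"
proof -
  have ee: "e i \<bullet> e j = (if i = j then 1 else 0)" and e\<nu>: "e i \<bullet> \<nu> = 0" for i j
    using assms by (auto simp: orthonormal_frame_def)
  show "frame_comb e x \<bullet> frame_comb e y = x \<bullet> y"
  proof -
    have "frame_comb e x \<bullet> w = (\<Sum>i\<in>UNIV. x $ i * (e i \<bullet> w))" for w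
      by (simp only: frame_comb_def inner_sum_left inner_scaleR_left)
    moreover have "e i \<bullet> frame_comb e y = y $ i" for i
      by (simp add: frame_comb_def inner_sum_right ee if_distrib cong: if_cong)
    ultimately have "frame_comb e x \<bullet> frame_comb e y = (\<Sum>i\<in>UNIV. x $ i * y $ i)"
      by simp
    then show ?thesis by (simp add: inner_vec_def)
  qed
  show "frame_comb e x \<bullet> \<nu> = 0"
    by (simp add: frame_comb_def inner_sum_left e\<nu>)
  then show "\<nu> \<bullet> frame_comb e x = 0" by (simp add: inner_commute)
qed

lemma quadratic_remainder_has_derivative:
  fixes f :: "'a::real_normed_vector \<Rightarrow> real"
  assumes "open U" "x \<in> U" "bounded_linear D"
    and r: "\<And>y. y \<in> U \<Longrightarrow> \<bar>f y - f x - D (y - x)\<bar> \<le> C * (norm (y - x))\<^sup>2"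
  shows "(f has_derivative D) (at x)"
  unfolding has_derivative_at_alt
proof (intro conjI allI impI)
  fix \<epsilon> :: real assume \<epsilon>: "\<epsilon> > 0"
  obtain d where d: "d > 0" "ball x d \<subseteq> U"
    using assms(1,2) open_contains_ball by blast
  define k where "k = min d (\<epsilon> / (\<bar>C\<bar> + 1))"
  have "k \<le> \<epsilon> / (\<bar>C\<bar> + 1)" by (simp add: k_def)
  then have k: "k > 0" "k \<le> d" "k * (\<bar>C\<bar> + 1) \<le> \<epsilon>"
    using d \<epsilon> by (simp_all add: k_def pos_le_divide_eq[symmetric])
  have "norm (f y - f x - D (y - x)) \<le> \<epsilon> * norm (y - x)" if y: "norm (y - x) < k" for y
  proof -
    have "y \<in> U" using y k d by (auto simp: dist_norm norm_minus_commute subset_iff)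
    from r[OF this] have "norm (f y - f x - D (y - x)) \<le> (C * norm (y - x)) * norm (y - x)"
      by (simp add: power2_eq_square)
    also have "\<dots> \<le> (\<bar>C\<bar> + 1) * k * norm (y - x)"
      using y by (intro mult_right_mono mult_mono) auto
    also have "\<dots> \<le> \<epsilon> * norm (y - x)"
      using k by (intro mult_right_mono) (auto simp: mult.commute)
    finally show ?thesis .
  qed
  then show "\<exists>d>0. \<forall>y. norm (y - x) < d \<longrightarrow> norm (f y - f x - D (y - x)) \<le> \<epsilon> * norm (y - x)"
    using k by blast
qed (rule assms)

text \<open>
  For the components of the gradient, which are quotients of components of the normal.
\<close>

lemma quotient_lipschitz:
  fixes a b c d :: real
  assumes "15 / 16 \<le> c" "15 / 16 \<le> d" "\<bar>a\<bar> \<le> 1" "\<bar>c\<bar> \<le> 1" "\<bar>a - b\<bar> \<le> \<delta>" "\<bar>c - d\<bar> \<le> \<delta>"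
  shows "\<bar>a / c - b / d\<bar> \<le> 3 * \<delta>"
proof -
  have "15 / 16 * (15 / 16) \<le> c * d"
    using assms by (intro mult_mono) auto
  then have cd: "2 / 3 \<le> c * d" by simp
  have "a / c - b / d = (a * (d - c) + c * (a - b)) / (c * d)"
    using assms by (simp add: field_simps)
  moreover have "\<bar>c * d\<bar> = c * d" "c * d \<noteq> 0"
    using cd by auto
  ultimately have "\<bar>a / c - b / d\<bar> * (c * d) = \<bar>a * (d - c) + c * (a - b)\<bar>"
    by (metis abs_mult nonzero_eq_divide_eq)
  also have "\<dots> \<le> \<bar>a\<bar> * \<bar>d - c\<bar> + \<bar>c\<bar> * \<bar>a - b\<bar>"
    by (metis abs_mult abs_triangle_ineq)
  also have "\<dots> \<le> 1 * \<delta> + 1 * \<delta>"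
    using assms by (intro add_mono mult_mono) (auto simp: abs_minus_commute)
  also have "\<dots> \<le> 3 * \<delta> * (c * d)"
    using mult_left_mono[OF cd, of "3 * \<delta>"] assms(5) by simp
  finally show ?thesis
    using cd by (simp add: mult_le_cancel_right)
qed

locale boundary_frame =
  fixes R :: real and E :: "(real ^ 'n::finite) set" and p :: "real ^ 'n"
    and e :: "'m::finite \<Rightarrow> real ^ 'n" and \<nu> :: "real ^ 'n"
  assumes R: "R > 0" and E: "E \<in> ball_class R"
    and frame: "orthonormal_frame (e, \<nu>)" and normal: "outer_normal R E p \<nu>"
begin

abbreviation F :: "real ^ 'm \<Rightarrow> real \<Rightarrow> real ^ 'n" where
  "F x z \<equiv> from_coords p (e, \<nu>) (x, z)"

lemma inner_axis_self: "\<nu> \<bullet> \<nu> = 1"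
  using normal by (simp add: outer_normal_def)

lemma closed_E: "closed E"
  using E by (simp add: ball_class_def)

lemma F_diff: "F y w - F x z = frame_comb e (y - x) + (w - z) *\<^sub>R \<nu>"
  by (simp add: from_coords_eq linear_diff[OF linear_frame_comb] scaleR_left_diff_distrib)

lemma F_p_diff: "F x z - p = frame_comb e x + z *\<^sub>R \<nu>"
  by (simp add: from_coords_eq)

lemma inner_coords:
  "(frame_comb e x + z *\<^sub>R \<nu>) \<bullet> (frame_comb e x + z *\<^sub>R \<nu>) = (norm x)\<^sup>2 + z\<^sup>2"
  unfolding inner_add_left inner_add_right power2_norm_eq_inner
  by (simp add: inner_frame_comb[OF frame] inner_axis_self power2_eq_square)

lemma norm_frame_comb: "norm (frame_comb e x) = norm x"
  by (simp add: norm_eq_sqrt_inner inner_frame_comb[OF frame])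

text \<open>
  The quadratic estimate at the base point reads \<open>\<bar>z\<bar> (2 R) \<le> \<bar>x\<bar>\<^sup>2 + z\<^sup>2\<close>.  In the cylinder it
  excludes all but the small solutions, because \<open>\<bar>z\<bar> < R\<close> gives \<open>z\<^sup>2 \<le> \<bar>z\<bar> R\<close>.
\<close>

lemma height_bound:
  assumes q: "F x z \<in> frontier E" and x: "norm x < R / 4" and z: "\<bar>z\<bar> < R"
  shows "\<bar>z\<bar> \<le> R / 16"
proof (rule ccontr)
  assume "\<not> \<bar>z\<bar> \<le> R / 16"
  have "\<bar>\<nu> \<bullet> (F x z - p)\<bar> \<le> ((F x z - p) \<bullet> (F x z - p)) / (2 * R)"
    by (rule outer_normal_quadratic[OF normal closed_E q R])
  then have "\<bar>z\<bar> * (2 * R) \<le> (norm x)\<^sup>2 + z\<^sup>2"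
    using R unfolding F_p_diff inner_coords
    by (simp add: inner_add_right inner_frame_comb[OF frame] inner_axis_self pos_le_divide_eq)
  moreover have "z\<^sup>2 \<le> \<bar>z\<bar> * R"
    using z by (simp add: power2_eq_square abs_mult_self_eq[of z, symmetric] mult_left_mono del: abs_mult_self_eq)
  moreover have "(norm x)\<^sup>2 \<le> (R / 4)\<^sup>2"
    using x by (intro power_mono) auto
  ultimately have "\<bar>z\<bar> * R \<le> R / 16 * R"
    by (simp add: power2_eq_square algebra_simps)
  then show False
    using R \<open>\<not> \<bar>z\<bar> \<le> R / 16\<close> by (simp add: mult_le_cancel_right)
qed

text \<open>
  By \<open>height_bound\<close> the point is at distance at most \<open>R / 3\<close> from \<open>p\<close>, so its normal is within \<open>1 / 3\<close>
  of \<open>\<nu>\<close>: almost vertical, with a small horizontal part.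
\<close>

lemma normal_in_cylinder:
  assumes q: "F x z \<in> frontier E" and x: "norm x < R / 4" and z: "\<bar>z\<bar> < R"
    and N: "outer_normal R E (F x z) N"
  shows "15 / 16 \<le> N \<bullet> \<nu>" "\<bar>N \<bullet> frame_comb e w\<bar> \<le> norm w / 3"
proof -
  have "z\<^sup>2 \<le> (R / 16)\<^sup>2"
    using height_bound[OF q x z] R by (intro abs_le_square_iff[THEN iffD1]) simp
  moreover have "(norm x)\<^sup>2 \<le> (R / 4)\<^sup>2"
    using x by (intro power_mono) auto
  ultimately have "(norm (F x z - p))\<^sup>2 \<le> (R / 4)\<^sup>2 + (R / 16)\<^sup>2"
    by (simp add: power2_norm_eq_inner F_p_diff inner_coords)
  also have "\<dots> \<le> (R / 3)\<^sup>2"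
    by (simp add: power2_eq_square)
  finally have "norm (F x z - p) \<le> R / 3"
    by (rule power2_le_imp_le) (use R in simp)
  then have "norm (F x z - p) / R \<le> 1 / 3"
    using R by (simp add: divide_le_eq)
  then have close: "norm (N - \<nu>) \<le> 1 / 3"
    using outer_normal_lipschitz[OF N normal R] by linarith
  then have "(norm (N - \<nu>))\<^sup>2 \<le> (1 / 3)\<^sup>2"
    by (intro power_mono) auto
  moreover have "(norm (N - \<nu>))\<^sup>2 = 2 - 2 * (N \<bullet> \<nu>)"
    using N by (simp add: power2_norm_eq_inner inner_diff_left inner_diff_right inner_axis_self outer_normal_def inner_commute)
  ultimately show "15 / 16 \<le> N \<bullet> \<nu>"
    by (simp add: power2_eq_square)
  have "N \<bullet> frame_comb e w = (N - \<nu>) \<bullet> frame_comb e w"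
    by (simp add: inner_diff_left inner_frame_comb[OF frame])
  then have "\<bar>N \<bullet> frame_comb e w\<bar> \<le> norm (N - \<nu>) * norm w"
    using Cauchy_Schwarz_ineq2[of "N - \<nu>" "frame_comb e w"] by (simp add: norm_frame_comb)
  also have "\<dots> \<le> 1 / 3 * norm w"
    using close by (rule mult_right_mono) simp
  finally show "\<bar>N \<bullet> frame_comb e w\<bar> \<le> norm w / 3" by simp
qed

text \<open>
  The heart of the graph property.  With \<open>u\<close> and \<open>t\<close> the horizontal and vertical distance of two
  boundary points of the cylinder, the quadratic estimate at the first one bounds \<open>15 / 16 * t\<close> by
  \<open>u / 3 + u / 4 + t / 16\<close>, whence \<open>t \<le> u\<close>.  The case \<open>u = 0\<close> says that a vertical line carries at
  most one such point.
\<close>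

lemma two_boundary_points:
  assumes q: "F x z \<in> frontier E" and x: "norm x < R / 4" and z: "\<bar>z\<bar> < R"
    and q': "F y w \<in> frontier E" and y: "norm y < R / 4" and w: "\<bar>w\<bar> < R"
    and N: "outer_normal R E (F x z) N"
  shows "\<bar>w - z\<bar> \<le> norm (y - x)"
    and "\<bar>N \<bullet> frame_comb e (y - x) + (N \<bullet> \<nu>) * (w - z)\<bar> \<le> (norm (y - x))\<^sup>2 / R"
    and "norm (F y w - F x z) \<le> 2 * norm (y - x)"
proof -
  define u t where "u = norm (y - x)" and "t = \<bar>w - z\<bar>"
  have ut: "u \<ge> 0" "t \<ge> 0" by (simp_all add: u_def t_def)
  have sq: "(F y w - F x z) \<bullet> (F y w - F x z) = u\<^sup>2 + t\<^sup>2"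
    by (simp add: F_diff inner_coords u_def t_def)
  have tay: "\<bar>N \<bullet> frame_comb e (y - x) + (N \<bullet> \<nu>) * (w - z)\<bar> \<le> (u\<^sup>2 + t\<^sup>2) / (2 * R)"
    using outer_normal_quadratic[OF N closed_E q' R] unfolding sq
    by (simp add: F_diff inner_add_right mult.commute)
  have "u \<le> R / 2"
    using norm_triangle_ineq4[of y x] x y by (simp add: u_def)
  have "t \<le> R / 8"
    using height_bound[OF q x z] height_bound[OF q' y w] abs_triangle_ineq4[of w z]
    unfolding t_def by linarith
  have "u\<^sup>2 / (2 * R) \<le> u / 4"
    using mult_left_mono[OF \<open>u \<le> R / 2\<close> ut(1)] R by (simp add: power2_eq_square field_simps)
  moreover have "t\<^sup>2 / (2 * R) \<le> t / 16"
    using mult_left_mono[OF \<open>t \<le> R / 8\<close> ut(2)] R by (simp add: power2_eq_square field_simps)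
  ultimately have "(u\<^sup>2 + t\<^sup>2) / (2 * R) \<le> u / 4 + t / 16"
    by (simp add: add_divide_distrib)
  moreover have "15 / 16 * t \<le> \<bar>(N \<bullet> \<nu>) * (w - z)\<bar>"
  proof -
    have "15 / 16 * t \<le> (N \<bullet> \<nu>) * t"
      using normal_in_cylinder(1)[OF q x z N] ut(2) by (rule mult_right_mono)
    then show ?thesis
      using normal_in_cylinder(1)[OF q x z N] by (simp add: abs_mult t_def)
  qed
  moreover have "\<bar>N \<bullet> frame_comb e (y - x)\<bar> \<le> u / 3"
    using normal_in_cylinder(2)[OF q x z N] by (simp add: u_def)
  ultimately have tu: "t \<le> u"
    using tay ut by argo
  then show "\<bar>w - z\<bar> \<le> norm (y - x)" by (simp add: u_def t_def)
  have "t\<^sup>2 \<le> u\<^sup>2" using tu ut by (intro power_mono)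
  then have "(u\<^sup>2 + t\<^sup>2) / (2 * R) \<le> (2 * u\<^sup>2) / (2 * R)"
    using R by (intro divide_right_mono) auto
  with tay show "\<bar>N \<bullet> frame_comb e (y - x) + (N \<bullet> \<nu>) * (w - z)\<bar> \<le> (norm (y - x))\<^sup>2 / R"
    by (simp add: u_def)
  have "(norm (F y w - F x z))\<^sup>2 \<le> (2 * u)\<^sup>2"
  proof -
    have "t\<^sup>2 \<le> 3 * u\<^sup>2"
      using \<open>t\<^sup>2 \<le> u\<^sup>2\<close> zero_le_power2[of u] by linarith
    then show ?thesis
      by (simp add: power2_norm_eq_inner sq power_mult_distrib)
  qed
  then show "norm (F y w - F x z) \<le> 2 * norm (y - x)"
    unfolding u_def by (rule power2_le_imp_le) simp
qed

text \<open>
  At height \<open>- R / 2\<close> the line is inside the interior ball and at height \<open>R / 2\<close> inside the exterior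
  one, so the segment between meets the boundary.
\<close>

lemma boundary_point_on_line:
  assumes x: "norm x < R / 4"
  obtains z where "\<bar>z\<bar> < R" "F x z \<in> frontier E"
proof -
  define L where "L = F x ` {-R<..<R}"
  have "continuous_on {-R<..<R} (F x)"
    unfolding from_coords_eq by (intro continuous_intros)
  then have "connected L"
    unfolding L_def by (intro connected_continuous_image) auto
  have near: "F x z \<in> ball (p + r *\<^sub>R \<nu>) R" if "\<bar>z - r\<bar> = R / 2" for z r
  proof -
    have "(norm (F x z - (p + r *\<^sub>R \<nu>)))\<^sup>2 = (norm x)\<^sup>2 + (z - r)\<^sup>2"
    proof -
      have "F x z - (p + r *\<^sub>R \<nu>) = frame_comb e x + (z - r) *\<^sub>R \<nu>"
        by (simp add: from_coords_eq algebra_simps)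
      then show ?thesis
        by (simp only: power2_norm_eq_inner inner_coords)
    qed
    also have "\<dots> = (norm x)\<^sup>2 + (R / 2)\<^sup>2"
      using that by (metis power2_abs)
    also have "\<dots> \<le> (R / 4)\<^sup>2 + (R / 2)\<^sup>2"
      using x by (intro add_right_mono power_mono) auto
    also have "\<dots> < R\<^sup>2"
      using R by (simp add: power2_eq_square)
    finally have "norm (F x z - (p + r *\<^sub>R \<nu>)) < R"
      by (rule power2_less_imp_less) (use R in simp)
    then show ?thesis by (simp add: dist_norm norm_minus_commute)
  qed
  have "F x (- R / 2) \<in> E"
    using near[of "- R / 2" "- R"] R normal by (auto simp: outer_normal_def)
  moreover have "F x (R / 2) \<notin> E"
    using near[of "R / 2" R] R normal by (auto simp: outer_normal_def)
  moreover have "F x (- R / 2) \<in> L" "F x (R / 2) \<in> L"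
    using R by (auto simp: L_def)
  ultimately have "L \<inter> frontier E \<noteq> {}"
    using connected_Int_frontier[OF \<open>connected L\<close>, of E] by blast
  then obtain z where "z \<in> {-R<..<R}" "F x z \<in> frontier E"
    unfolding L_def by blast
  then show ?thesis
    by (intro that[of z]) (auto simp: abs_less_iff)
qed

text \<open>
  The gradient of \<open>f\<close> at \<open>x\<close> is minus the horizontal part of the normal above \<open>x\<close> divided by its
  vertical part \<open>c x\<close>; it is Lipschitz because the normal is, with \<open>c x\<close> bounded away from zero.
\<close>

lemma boundary_is_C11_graph:
  obtains f :: "real ^ 'm \<Rightarrow> real" where
    "frontier E \<inter> from_coords p (e, \<nu>) ` (ball 0 (R / 4) \<times> {-R<..<R}) =
      from_coords p (e, \<nu>) ` {(x, z). x \<in> ball 0 (R / 4) \<and> z = f x}"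
    "\<And>x. x \<in> ball 0 (R / 4) \<Longrightarrow> \<bar>f x\<bar> \<le> R"
    "1-lipschitz_on (ball 0 (R / 4)) f"
    "\<And>x. x \<in> ball 0 (R / 4) \<Longrightarrow> f differentiable (at x)"
    "\<And>i. (6 / R)-lipschitz_on (ball 0 (R / 4)) (partial_deriv i f)"
proof -
  define U :: "(real ^ 'm) set" where "U = ball 0 (R / 4)"
  have U: "norm x < R / 4" if "x \<in> U" for x using that by (simp add: U_def)
  have "\<forall>x \<in> U. \<exists>z. \<bar>z\<bar> < R \<and> F x z \<in> frontier E"
    using boundary_point_on_line U by metis
  then obtain f where fR: "\<And>x. x \<in> U \<Longrightarrow> \<bar>f x\<bar> < R" and fE: "\<And>x. x \<in> U \<Longrightarrow> F x (f x) \<in> frontier E"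
    by metis
  have "\<forall>x \<in> U. \<exists>N. outer_normal R E (F x (f x)) N"
    using outer_normal_exists[OF E fE R] by blast
  then obtain N where N: "\<And>x. x \<in> U \<Longrightarrow> outer_normal R E (F x (f x)) (N x)"
    by metis
  note pts = two_boundary_points[OF fE U fR fE U fR N]
  have uniq: "z = f x" if "x \<in> U" "\<bar>z\<bar> < R" "F x z \<in> frontier E" for x z
    using two_boundary_points(1)[OF fE[OF that(1)] U[OF that(1)] fR[OF that(1)] that(3)
        U[OF that(1)] that(2) N[OF that(1)]] by simp
  have graph: "frontier E \<inter> from_coords p (e, \<nu>) ` (U \<times> {-R<..<R}) =
      from_coords p (e, \<nu>) ` {(x, z). x \<in> U \<and> z = f x}"
  proof (intro equalityI subsetI)
    fix q assume "q \<in> frontier E \<inter> from_coords p (e, \<nu>) ` (U \<times> {-R<..<R})"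
    then obtain x z where q: "q = F x z" "q \<in> frontier E" "x \<in> U" "\<bar>z\<bar> < R"
      by (auto simp: abs_less_iff)
    then have "z = f x" using uniq by simp
    with q show "q \<in> from_coords p (e, \<nu>) ` {(x, z). x \<in> U \<and> z = f x}" by auto
  next
    fix q assume "q \<in> from_coords p (e, \<nu>) ` {(x, z). x \<in> U \<and> z = f x}"
    then obtain x where q: "q = F x (f x)" "x \<in> U" by auto
    have "f x \<in> {-R<..<R}" using fR[OF q(2)] by (auto simp: abs_less_iff)
    with q fE[OF q(2)] show "q \<in> frontier E \<inter> from_coords p (e, \<nu>) ` (U \<times> {-R<..<R})"
      by blast
  qed
  define c where "c x = N x \<bullet> \<nu>" for x
  have c: "15 / 16 \<le> c x" if "x \<in> U" for x
    using normal_in_cylinder(1)[OF fE U fR N] that by (simp add: c_def)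
  define D where "D x w = - (N x \<bullet> frame_comb e w) / c x" for x w
  have D: "(f has_derivative D x) (at x)" if x: "x \<in> U" for x
  proof (rule quadratic_remainder_has_derivative[where C="2 / R"])
    show "open U" "x \<in> U" using x by (simp_all add: U_def)
    have "linear (D x)"
      by (rule linearI)
        (simp_all add: D_def linear_add[OF linear_frame_comb] linear_scale[OF linear_frame_comb]
          inner_add_right add_divide_distrib diff_divide_distrib)
    then show "bounded_linear (D x)" by (simp add: linear_conv_bounded_linear)
    fix y assume y: "y \<in> U"
    have "f y - f x - D x (y - x) = (N x \<bullet> frame_comb e (y - x) + c x * (f y - f x)) / c x"
      using c[OF x] by (simp add: D_def field_simps)
    also have "\<bar>\<dots>\<bar> = \<bar>N x \<bullet> frame_comb e (y - x) + c x * (f y - f x)\<bar> / c x"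
      using c[OF x] by simp
    \<comment> \<open>The bound \<open>15 / 16 \<le> c x\<close> is weakened to \<open>1 / 2\<close>
        to have the simple constant \<open>2 / R\<close>.\<close>
    also have "\<dots> \<le> ((norm (y - x))\<^sup>2 / R) / (1 / 2)"
      using pts(2)[OF x x x y y y x] c[OF x] by (intro frac_le) (auto simp: c_def)
    finally show "\<bar>f y - f x - D x (y - x)\<bar> \<le> 2 / R * (norm (y - x))\<^sup>2" by (simp add: mult.commute)
  qed
  have pd: "partial_deriv i f x = - (N x \<bullet> e i) / c x" if "x \<in> U" for i x
    using frechet_derivative_at[OF D[OF that], symmetric] by (simp add: partial_deriv_def D_def)
  have "(6 / R)-lipschitz_on U (partial_deriv i f)" for i
  proof (rule lipschitz_onI)
    fix x y assume x: "x \<in> U" and y: "y \<in> U"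
    have unit: "norm (e i) = 1" "norm \<nu> = 1" "norm (N x) = 1"
      using frame N[OF x] by (simp_all add: norm_eq_1 orthonormal_frame_def outer_normal_def)
    define \<delta> where "\<delta> = norm (N x - N y)"
    have CS: "\<bar>v \<bullet> w\<bar> \<le> norm v" if "norm w = 1" for v w :: "real ^ 'n"
      using Cauchy_Schwarz_ineq2[of v w] that by simp
    \<comment> \<open>The constant \<open>6 / R\<close> arises as \<open>3\<close> from the
        quotient, \<open>1 / R\<close> from the normal, and \<open>2\<close> from comparing the
        distance of the boundary points with that of their projections.\<close>
    have "\<bar>(N x \<bullet> e i) / c x - (N y \<bullet> e i) / c y\<bar> \<le> 3 * \<delta>"
    proof (rule quotient_lipschitz)
      show "15 / 16 \<le> c x" "15 / 16 \<le> c y" using c x y by auto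
      show "\<bar>N x \<bullet> e i\<bar> \<le> 1" "\<bar>c x\<bar> \<le> 1"
        using CS[OF unit(1), of "N x"] CS[OF unit(2), of "N x"] unit(3) by (auto simp: c_def)
      show "\<bar>N x \<bullet> e i - N y \<bullet> e i\<bar> \<le> \<delta>" "\<bar>c x - c y\<bar> \<le> \<delta>"
        using CS[OF unit(1), of "N x - N y"] CS[OF unit(2), of "N x - N y"]
        by (auto simp: c_def \<delta>_def inner_diff_left)
    qed
    moreover have "\<delta> \<le> norm (F x (f x) - F y (f y)) / R"
      unfolding \<delta>_def by (rule outer_normal_lipschitz[OF N[OF x] N[OF y] R])
    moreover have "norm (F x (f x) - F y (f y)) / R \<le> (2 * norm (x - y)) / R"
      using pts(3)[OF y y y x x x y] R by (intro divide_right_mono) auto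
    ultimately have "\<bar>(N x \<bullet> e i) / c x - (N y \<bullet> e i) / c y\<bar> \<le> 3 * ((2 * norm (x - y)) / R)"
      by linarith
    then show "dist (partial_deriv i f x) (partial_deriv i f y) \<le> 6 / R * dist x y"
      by (simp add: pd x y dist_norm abs_minus_commute)
  qed (use R in simp)
  moreover have "1-lipschitz_on U f"
  proof (rule lipschitz_onI)
    fix x y assume x: "x \<in> U" and y: "y \<in> U"
    show "dist (f x) (f y) \<le> 1 * dist x y"
      using pts(1)[OF y y y x x x y] by (simp add: dist_norm)
  qed simp
  moreover have "f differentiable (at x)" if "x \<in> U" for x
    using D[OF that] by (auto simp: differentiable_def)
  ultimately show ?thesis
    using that[of f] graph fR less_imp_le unfolding U_def by blast
qed

end

theorem proposition2p1:
  fixes R :: real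
  assumes "CARD('n::finite) \<ge> 2"
    and "CARD('m::finite) = CARD('n) - 1"
    and "R > 0"
  shows "\<exists>\<rho>>0. \<exists>M::real.
    \<forall>E \<in> (ball_class R :: (real ^ 'n) set set). \<forall>p\<^sub>0 \<in> frontier E.
    \<forall>S \<in> (coord_systems R E p\<^sub>0 :: (('m \<Rightarrow> real ^ 'n) \<times> (real ^ 'n)) set).
    \<exists>f :: real ^ 'm \<Rightarrow> real.
      frontier E \<inter> from_coords p\<^sub>0 S ` (ball 0 \<rho> \<times> {-R<..<R}) =
        from_coords p\<^sub>0 S ` {(x, z). x \<in> ball 0 \<rho> \<and> z = f x} \<and>
      f \<in> sobolev_inf 2 (ball 0 \<rho>) \<and>
      sobolev_inf_norm 2 (ball 0 \<rho>) f \<le> ennreal M"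
proof (rule exI[of _ "R / 4"], intro conjI exI[of _ "1 + R + 6 / R"] ballI)
  show "R / 4 > 0" using assms(3) by simp
  fix E :: "(real ^ 'n) set" and p\<^sub>0 :: "real ^ 'n" and S :: "('m \<Rightarrow> real ^ 'n) \<times> (real ^ 'n)"
  assume E: "E \<in> ball_class R" and S: "S \<in> coord_systems R E p\<^sub>0"
  obtain e \<nu> where S_eq: "S = (e, \<nu>)" by fastforce
  interpret boundary_frame R E p\<^sub>0 e \<nu>
    using S E assms(3) tangent_balls_outer_normal[of R E p\<^sub>0]
    by unfold_locales (auto simp: coord_systems_def S_eq)
  obtain f :: "real ^ 'm \<Rightarrow> real" where f:
    "frontier E \<inter> from_coords p\<^sub>0 (e, \<nu>) ` (ball 0 (R / 4) \<times> {-R<..<R}) =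
      from_coords p\<^sub>0 (e, \<nu>) ` {(x, z). x \<in> ball 0 (R / 4) \<and> z = f x}"
    "\<And>x. x \<in> ball 0 (R / 4) \<Longrightarrow> \<bar>f x\<bar> \<le> R"
    "1-lipschitz_on (ball 0 (R / 4)) f"
    "\<And>x. x \<in> ball 0 (R / 4) \<Longrightarrow> f differentiable (at x)"
    "\<And>i. (6 / R)-lipschitz_on (ball 0 (R / 4)) (partial_deriv i f)"
    by (rule boundary_is_C11_graph) (rule that)
  have M: "R \<le> 1 + R + 6 / R" "1 \<le> 1 + R + 6 / R" "6 / R \<le> 1 + R + 6 / R"
    using assms(3) by simp_all
  have "\<bar>f x\<bar> \<le> 1 + R + 6 / R" if "x \<in> ball 0 (R / 4)" for x
    using f(2)[OF that] M(1) by (rule order_trans)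
  note C11_imp_sobolev_inf_2[OF open_ball bounded_ball this lipschitz_on_le[OF f(3) M(2)] f(4)
      lipschitz_on_le[OF f(5) M(3)]]
  then show "\<exists>f :: real ^ 'm \<Rightarrow> real.
      frontier E \<inter> from_coords p\<^sub>0 S ` (ball 0 (R / 4) \<times> {-R<..<R}) =
        from_coords p\<^sub>0 S ` {(x, z). x \<in> ball 0 (R / 4) \<and> z = f x} \<and>
      f \<in> sobolev_inf 2 (ball 0 (R / 4)) \<and>
      sobolev_inf_norm 2 (ball 0 (R / 4)) f \<le> ennreal (1 + R + 6 / R)"
    using f(1) unfolding S_eq by blast
qed

end
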